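(* For every $p\in[1,2)$ the space $L_p=L_p[0,1]$ contains an uncomplemented (closed linear) subspace $W$ which is isomorphic to the Hilbert space $l_2$.
   Context: A closed subspace $X$ of a Banach space $Y$ is complemented in $Y$ if there is a bounded linear projection of $Y$ onto $X$, and uncomplemented otherwise. "Isomorphic" means linearly homeomorphic. *)

theory Defs
  imports "HOL-Analysis.Analysis"
begin

abbreviation unit_leb :: "real measure" where
  "unit_leb \<equiv> lebesgue_on {0..1}"

text \<open>
  The spaces \<open>L\<^sub>p[0,1]\<close> for the various \<open>p\<close> live in one common real vector space, the space of
  almost-everywhere classes of real-valued Lebesgue measurable functions on \<open>[0,1]\<close>. Representatives
  are total functions on the reals; their values outside \<open>[0,1]\<close> are irrelevant.
\<close>

definition ae_eq :: "(real \<Rightarrow> real) \<Rightarrow> (real \<Rightarrow> real) \<Rightarrow> bool" where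
  "ae_eq f g \<longleftrightarrow> f \<in> borel_measurable unit_leb \<and> g \<in> borel_measurable unit_leb \<and>
     (AE x in unit_leb. f x = g x)"

lemma part_equivp_ae_eq: "part_equivp ae_eq"
proof (rule part_equivpI)
  show "\<exists>f. ae_eq f f"
    by (rule exI[of _ "\<lambda>_. 0"]) (simp add: ae_eq_def)
  show "symp ae_eq"
    by (auto simp: symp_def ae_eq_def elim: eventually_mono)
  show "transp ae_eq"
    unfolding transp_def ae_eq_def by (auto elim: eventually_elim2)
qed

quotient_type L0 = "real \<Rightarrow> real" / partial: ae_eq
  by (rule part_equivp_ae_eq)

instantiation L0 :: real_vector
begin

lift_definition zero_L0 :: L0 is "\<lambda>_. 0"
  by (simp add: ae_eq_def)

lift_definition plus_L0 :: "L0 \<Rightarrow> L0 \<Rightarrow> L0" is "\<lambda>f g x. f x + g x"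
  unfolding ae_eq_def by (auto elim: eventually_elim2)

lift_definition uminus_L0 :: "L0 \<Rightarrow> L0" is "\<lambda>f x. - f x"
  unfolding ae_eq_def by (auto elim: eventually_mono)

lift_definition minus_L0 :: "L0 \<Rightarrow> L0 \<Rightarrow> L0" is "\<lambda>f g x. f x - g x"
  unfolding ae_eq_def by (auto elim: eventually_elim2)

lift_definition scaleR_L0 :: "real \<Rightarrow> L0 \<Rightarrow> L0" is "\<lambda>c f x. c * f x"
  unfolding ae_eq_def by (auto elim: eventually_mono)

instance
  by standard (transfer, auto simp: ae_eq_def algebra_simps elim!: eventually_mono)+

end

lift_definition in_Lp :: "real \<Rightarrow> L0 \<Rightarrow> bool" is
  "\<lambda>p f. integrable unit_leb (\<lambda>x. \<bar>f x\<bar> powr p)"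
  unfolding ae_eq_def by (rule integrable_cong_AE) (auto elim: eventually_mono)

lift_definition Lp_norm :: "real \<Rightarrow> L0 \<Rightarrow> real" is
  "\<lambda>p f. (integral\<^sup>L unit_leb (\<lambda>x. \<bar>f x\<bar> powr p)) powr (1 / p)"
  unfolding ae_eq_def
  by (rule arg_cong[where f = "\<lambda>t. t powr _"], rule integral_cong_AE) (auto elim: eventually_mono)

definition Lp :: "real \<Rightarrow> L0 set" where
  "Lp p = {f. in_Lp p f}"

abbreviation Lp_dist :: "real \<Rightarrow> L0 \<Rightarrow> L0 \<Rightarrow> real" where
  "Lp_dist p f g \<equiv> Lp_norm p (f - g)"

definition Lp_topology :: "real \<Rightarrow> L0 topology" where
  "Lp_topology p = Metric_space.mtopology (Lp p) (Lp_dist p)"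


text \<open>
  \<open>Metric_space.mtopology\<close> is only meaningful for a genuine metric; the following lemmas, ending in
  \<open>Metric_space_Lp\<close>, show that this is the case for \<open>p \<ge> 1\<close>.
\<close>

lemma powr_abs_add_bound:
  fixes a b p :: real
  assumes "1 \<le> p"
  shows "\<bar>a + b\<bar> powr p \<le> 2 powr p * (\<bar>a\<bar> powr p + \<bar>b\<bar> powr p)"
proof -
  have "\<bar>a + b\<bar> \<le> 2 * max \<bar>a\<bar> \<bar>b\<bar>"
    by linarith
  then have "\<bar>a + b\<bar> powr p \<le> (2 * max \<bar>a\<bar> \<bar>b\<bar>) powr p"
    using assms by (intro powr_mono2) auto
  also have "\<dots> = 2 powr p * (max \<bar>a\<bar> \<bar>b\<bar>) powr p"
    by (simp add: powr_mult)
  also have "\<dots> \<le> 2 powr p * (\<bar>a\<bar> powr p + \<bar>b\<bar> powr p)"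
    by (intro mult_left_mono) (auto simp: max_def)
  finally show ?thesis .
qed

lemma subspace_Lp:
  assumes "1 \<le> p"
  shows "subspace (Lp p)"
proof (rule subspaceI)
  show "0 \<in> Lp p"
    unfolding Lp_def mem_Collect_eq by transfer (use assms in simp)
next
  fix f g assume "f \<in> Lp p" "g \<in> Lp p"
  then show "f + g \<in> Lp p"
    unfolding Lp_def mem_Collect_eq
  proof (transfer fixing: p)
    fix f g :: "real \<Rightarrow> real"
    assume m: "ae_eq f f" "ae_eq g g"
      and i: "integrable unit_leb (\<lambda>x. \<bar>f x\<bar> powr p)" "integrable unit_leb (\<lambda>x. \<bar>g x\<bar> powr p)"
    have [measurable]: "f \<in> borel_measurable unit_leb" "g \<in> borel_measurable unit_leb"
      using m by (auto simp: ae_eq_def)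
    have "integrable unit_leb (\<lambda>x. 2 powr p * (\<bar>f x\<bar> powr p + \<bar>g x\<bar> powr p))"
      using i by auto
    then show "integrable unit_leb (\<lambda>x. \<bar>f x + g x\<bar> powr p)"
      by (rule Bochner_Integration.integrable_bound)
        (use powr_abs_add_bound[OF assms] in auto)
  qed
next
  fix c f assume "f \<in> Lp p"
  then show "c *\<^sub>R f \<in> Lp p"
    unfolding Lp_def mem_Collect_eq by transfer (simp add: abs_mult powr_mult)
qed

lemma Lp_norm_nonneg: "0 \<le> Lp_norm p f"
  by transfer simp

lemma Lp_norm_scaleR:
  assumes "1 \<le> p"
  shows "Lp_norm p (c *\<^sub>R f) = \<bar>c\<bar> * Lp_norm p f"
  using assms by transfer (simp add: abs_mult powr_mult powr_powr)

lemma Lp_norm_eq_0_iff: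
  assumes "1 \<le> p" "f \<in> Lp p"
  shows "Lp_norm p f = 0 \<longleftrightarrow> f = 0"
  using assms unfolding Lp_def mem_Collect_eq
proof (transfer fixing: p)
  fix f :: "real \<Rightarrow> real"
  assume m: "ae_eq f f" and i: "integrable unit_leb (\<lambda>x. \<bar>f x\<bar> powr p)"
  have "(integral\<^sup>L unit_leb (\<lambda>x. \<bar>f x\<bar> powr p) = 0) \<longleftrightarrow> (AE x in unit_leb. \<bar>f x\<bar> powr p = 0)"
    by (rule integral_nonneg_eq_0_iff_AE[OF i]) simp
  then show "(integral\<^sup>L unit_leb (\<lambda>x. \<bar>f x\<bar> powr p) powr (1 / p) = 0) = ae_eq f (\<lambda>_. 0)"
    using m by (simp add: ae_eq_def)
qed

lemma Lp_norm_triangle: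
  assumes p: "1 \<le> p" and fg: "f \<in> Lp p" "g \<in> Lp p"
  shows "Lp_norm p (f + g) \<le> Lp_norm p f + Lp_norm p g"
proof (cases "Lp_norm p f = 0 \<or> Lp_norm p g = 0")
  case True
  then show ?thesis
    using Lp_norm_eq_0_iff[OF p] fg Lp_norm_nonneg by auto
next
  case False
  define a where "a = Lp_norm p f"
  define b where "b = Lp_norm p g"
  have ab: "0 < a" "0 < b"
    using False Lp_norm_nonneg[of p f] Lp_norm_nonneg[of p g] by (auto simp: a_def b_def)
  have "f + g \<in> Lp p"
    using subspace_Lp[OF p] fg by (rule subspace_add)
  with fg a_def b_def have "Lp_norm p (f + g) \<le> a + b"
    unfolding Lp_def mem_Collect_eq
  proof (transfer fixing: p a b)
    fix f g :: "real \<Rightarrow> real"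
    assume m: "ae_eq f f" "ae_eq g g"
      and fi: "integrable unit_leb (\<lambda>x. \<bar>f x\<bar> powr p)"
      and gi: "integrable unit_leb (\<lambda>x. \<bar>g x\<bar> powr p)"
      and si: "integrable unit_leb (\<lambda>x. \<bar>f x + g x\<bar> powr p)"
      and a: "a = integral\<^sup>L unit_leb (\<lambda>x. \<bar>f x\<bar> powr p) powr (1 / p)"
      and b: "b = integral\<^sup>L unit_leb (\<lambda>x. \<bar>g x\<bar> powr p) powr (1 / p)"
    have ap: "a powr p = integral\<^sup>L unit_leb (\<lambda>x. \<bar>f x\<bar> powr p)"
      and bp: "b powr p = integral\<^sup>L unit_leb (\<lambda>x. \<bar>g x\<bar> powr p)"
      using p by (simp_all add: a b powr_powr)
    define s where "s = a / (a + b)"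
    define t where "t = b / (a + b)"
    have st: "0 < s" "0 < t" "s + t = 1"
      using ab by (auto simp: s_def t_def add_divide_distrib[symmetric])
    have conv: "(s * u + t * v) powr p \<le> s * u powr p + t * v powr p"
      if uv: "0 \<le> u" "0 \<le> v" for u v :: real
    proof -
      have le: "r powr p * w \<le> r * w" if "0 < r" "r < 1" "0 \<le> w" for r w :: real
        using powr_mono'[of 1 p r] that p by (intro mult_right_mono) auto
      consider "u = 0" | "v = 0" | "0 < u" "0 < v"
        using uv by linarith
      then show ?thesis
      proof cases
        case 1
        then show ?thesis
          using le[of t "v powr p"] st p by (simp add: powr_mult)
      next
        case 2
        then show ?thesis
          using le[of s "u powr p"] st p by (simp add: powr_mult)
      next
        case 3
        have s: "s = 1 - t"
          using st by simp
        show ?thesis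
          unfolding s using convex_onD[OF powr_convex[OF p], of t u v] st 3 by simp
      qed
    qed
    have pt: "\<bar>f x + g x\<bar> powr p \<le>
        (a + b) powr p * (s / a powr p * \<bar>f x\<bar> powr p + t / b powr p * \<bar>g x\<bar> powr p)" for x
    proof -
      have e: "s * (\<bar>f x\<bar> / a) + t * (\<bar>g x\<bar> / b) = (\<bar>f x\<bar> + \<bar>g x\<bar>) / (a + b)"
        using ab by (simp add: s_def t_def add_divide_distrib)
      have "\<bar>f x + g x\<bar> powr p \<le> ((a + b) * (s * (\<bar>f x\<bar> / a) + t * (\<bar>g x\<bar> / b))) powr p"
        unfolding e using ab p by (intro powr_mono2) auto
      also have "\<dots> = (a + b) powr p * (s * (\<bar>f x\<bar> / a) + t * (\<bar>g x\<bar> / b)) powr p"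
        using ab st by (intro powr_mult)
      also have "\<dots> \<le> (a + b) powr p * (s * (\<bar>f x\<bar> / a) powr p + t * (\<bar>g x\<bar> / b) powr p)"
        using ab by (intro mult_left_mono conv) auto
      finally show ?thesis
        using ab by (simp add: powr_divide)
    qed
    have "integral\<^sup>L unit_leb (\<lambda>x. \<bar>f x + g x\<bar> powr p) \<le>
        integral\<^sup>L unit_leb (\<lambda>x. (a + b) powr p *
          (s / a powr p * \<bar>f x\<bar> powr p + t / b powr p * \<bar>g x\<bar> powr p))"
      by (rule integral_mono[OF si _ pt]) (use fi gi in auto)
    also have "\<dots> = (a + b) powr p * (s / a powr p * a powr p + t / b powr p * b powr p)"
      using fi gi by (simp add: ap bp)
    also have "\<dots> = (a + b) powr p"
      using ab st by simp
    finally have "integral\<^sup>L unit_leb (\<lambda>x. \<bar>f x + g x\<bar> powr p) powr (1 / p)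
        \<le> ((a + b) powr p) powr (1 / p)"
      using p by (intro powr_mono2) auto
    then show "integral\<^sup>L unit_leb (\<lambda>x. \<bar>f x + g x\<bar> powr p) powr (1 / p) \<le> a + b"
      using ab p by (simp add: powr_powr)
  qed
  then show ?thesis
    by (simp add: a_def b_def)
qed

lemma Metric_space_Lp:
  assumes p: "1 \<le> p"
  shows "Metric_space (Lp p) (Lp_dist p)"
proof
  fix f g h :: L0
  show "0 \<le> Lp_dist p f g"
    by (rule Lp_norm_nonneg)
  show "Lp_dist p f g = Lp_dist p g f"
    using Lp_norm_scaleR[OF p, of "-1" "f - g"] by simp
  show "Lp_dist p f g = 0 \<longleftrightarrow> f = g" if "f \<in> Lp p" "g \<in> Lp p"
    using Lp_norm_eq_0_iff[OF p, of "f - g"] that subspace_diff[OF subspace_Lp[OF p]] by simp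
  show "Lp_dist p f h \<le> Lp_dist p f g + Lp_dist p g h"
    if "f \<in> Lp p" "g \<in> Lp p" "h \<in> Lp p"
    using Lp_norm_triangle[OF p, of "f - g" "g - h"] that subspace_diff[OF subspace_Lp[OF p]]
    by simp
qed

typedef ell2 = "{x :: nat \<Rightarrow> real. summable (\<lambda>n. (x n)\<^sup>2)}"
  by (rule exI[of _ "\<lambda>_. 0"]) simp

setup_lifting type_definition_ell2

lemma ell2_summable_mult:
  fixes x y :: "nat \<Rightarrow> real"
  assumes "summable (\<lambda>n. (x n)\<^sup>2)" "summable (\<lambda>n. (y n)\<^sup>2)"
  shows "summable (\<lambda>n. x n * y n)"
proof (rule summable_comparison_test'[OF summable_add[OF assms], where N = 0])
  fix n
  have "2 * (\<bar>x n\<bar> * \<bar>y n\<bar>) \<le> (x n)\<^sup>2 + (y n)\<^sup>2"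
    using sum_squares_bound[of "\<bar>x n\<bar>" "\<bar>y n\<bar>"] by simp
  moreover have "0 \<le> \<bar>x n\<bar> * \<bar>y n\<bar>"
    by simp
  ultimately show "norm (x n * y n) \<le> (x n)\<^sup>2 + (y n)\<^sup>2"
    unfolding real_norm_def abs_mult by linarith
qed

lemma ell2_summable_lincomb:
  fixes x y :: "nat \<Rightarrow> real"
  assumes "summable (\<lambda>n. (x n)\<^sup>2)" "summable (\<lambda>n. (y n)\<^sup>2)"
  shows "summable (\<lambda>n. (x n + c * y n)\<^sup>2)"
proof -
  have "(\<lambda>n. (x n + c * y n)\<^sup>2) = (\<lambda>n. (x n)\<^sup>2 + (2 * c) * (x n * y n) + c\<^sup>2 * (y n)\<^sup>2)"
    by (auto simp: power2_eq_square algebra_simps)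
  then show ?thesis
    using assms ell2_summable_mult[OF assms] by (simp add: summable_add summable_mult)
qed

instantiation ell2 :: real_inner
begin

lift_definition zero_ell2 :: ell2 is "\<lambda>_. 0"
  by simp

lift_definition plus_ell2 :: "ell2 \<Rightarrow> ell2 \<Rightarrow> ell2" is "\<lambda>x y n. x n + y n"
  using ell2_summable_lincomb[where c = 1] by simp

lift_definition uminus_ell2 :: "ell2 \<Rightarrow> ell2" is "\<lambda>x n. - x n"
  by simp

lift_definition minus_ell2 :: "ell2 \<Rightarrow> ell2 \<Rightarrow> ell2" is "\<lambda>x y n. x n - y n"
  using ell2_summable_lincomb[where c = "-1"] by simp

lift_definition scaleR_ell2 :: "real \<Rightarrow> ell2 \<Rightarrow> ell2" is "\<lambda>c x n. c * x n"
  by (simp add: power_mult_distrib summable_mult)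

lift_definition inner_ell2 :: "ell2 \<Rightarrow> ell2 \<Rightarrow> real" is "\<lambda>x y. \<Sum>n. x n * y n" .

definition norm_ell2 :: "ell2 \<Rightarrow> real" where
  "norm_ell2 x = sqrt (inner x x)"

definition dist_ell2 :: "ell2 \<Rightarrow> ell2 \<Rightarrow> real" where
  "dist_ell2 x y = norm (x - y)"

definition sgn_ell2 :: "ell2 \<Rightarrow> ell2" where
  "sgn_ell2 x = inverse (norm x) *\<^sub>R x"

definition uniformity_ell2 :: "(ell2 \<times> ell2) filter" where
  "uniformity_ell2 = (INF e\<in>{0 <..}. principal {(x, y). dist x y < e})"

definition open_ell2 :: "ell2 set \<Rightarrow> bool" where
  "open_ell2 U \<longleftrightarrow> (\<forall>x\<in>U. eventually (\<lambda>(x', y). x' = x \<longrightarrow> y \<in> U) uniformity)"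

instance
proof
  fix x y z :: ell2 and a b :: real and U :: "ell2 set"
  show "x + y + z = x + (y + z)" "x + y = y + x" "0 + x = x" "- x + x = 0" "x - y = x + - y"
    "a *\<^sub>R (x + y) = a *\<^sub>R x + a *\<^sub>R y" "(a + b) *\<^sub>R x = a *\<^sub>R x + b *\<^sub>R x"
    "a *\<^sub>R b *\<^sub>R x = (a * b) *\<^sub>R x" "1 *\<^sub>R x = x"
    by (transfer, simp add: algebra_simps)+
  show "sgn x = inverse (norm x) *\<^sub>R x" "dist x y = norm (x - y)"
    "(uniformity :: (ell2 \<times> ell2) filter) = (INF e\<in>{0 <..}. principal {(x, y). dist x y < e})"
    "open U \<longleftrightarrow> (\<forall>x\<in>U. eventually (\<lambda>(x', y). x' = x \<longrightarrow> y \<in> U) uniformity)"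
    "norm x = sqrt (inner x x)"
    by (simp_all only: sgn_ell2_def dist_ell2_def uniformity_ell2_def open_ell2_def norm_ell2_def)
  show "inner x y = inner y x"
    by transfer (simp add: mult.commute)
  show "inner (x + y) z = inner x z + inner y z"
    by transfer (simp add: distrib_right suminf_add ell2_summable_mult)
  show "inner (a *\<^sub>R x) y = a * inner x y"
    by transfer (simp add: mult.assoc suminf_mult ell2_summable_mult)
  show "0 \<le> inner x x"
    by transfer (simp add: suminf_nonneg power2_eq_square)
  show "inner x x = 0 \<longleftrightarrow> x = 0"
    by transfer (auto simp: suminf_eq_zero_iff power2_eq_square fun_eq_iff)
qed

end

definition bounded_linear_operator_on :: "real \<Rightarrow> (L0 \<Rightarrow> L0) \<Rightarrow> bool" where
  "bounded_linear_operator_on p P \<longleftrightarrow>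
     P ` Lp p \<subseteq> Lp p \<and>
     (\<forall>f\<in>Lp p. \<forall>g\<in>Lp p. P (f + g) = P f + P g) \<and>
     (\<forall>c. \<forall>f\<in>Lp p. P (c *\<^sub>R f) = c *\<^sub>R P f) \<and>
     (\<exists>C. \<forall>f\<in>Lp p. Lp_norm p (P f) \<le> C * Lp_norm p f)"

definition closed_subspace_Lp :: "real \<Rightarrow> L0 set \<Rightarrow> bool" where
  "closed_subspace_Lp p W \<longleftrightarrow> W \<subseteq> Lp p \<and> subspace W \<and> closedin (Lp_topology p) W"

definition complemented_in_Lp :: "real \<Rightarrow> L0 set \<Rightarrow> bool" where
  "complemented_in_Lp p W \<longleftrightarrow>
     (\<exists>P. bounded_linear_operator_on p P \<and> (\<forall>f\<in>Lp p. P (P f) = P f) \<and> P ` Lp p = W)"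

definition isomorphic_to_ell2 :: "real \<Rightarrow> L0 set \<Rightarrow> bool" where
  "isomorphic_to_ell2 p W \<longleftrightarrow>
     (\<exists>T :: ell2 \<Rightarrow> L0. linear T \<and> homeomorphic_map euclidean (subtopology (Lp_topology p) W) T)"

end

theory Submission
  imports Defs "HOL-Real_Asymp.Real_Asymp"
begin

text \<open>
  For a random \<open>N\<close> by \<open>n\<close> sign matrix, the span of its \<open>n\<close> columns in
  \<open>L\<^sub>p\<close> of \<open>N\<close> equal atoms is Hilbertian with constants independent of \<open>n\<close> and \<open>N\<close>, as long
  as \<open>n log n\<close> is small compared with \<open>N\<close>. If a Hilbertian subspace of \<open>L\<^sub>p\<close> contains such a span
  and is the range of a projection \<open>P\<close>, apply \<open>P\<close> to the indicators of the atoms, which have norm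
  \<open>N powr (- 1 / p)\<close>: the biorthogonality of the coordinates with the columns gives
  \<open>n \<le> sqrt n * N * const * N powr (- 1 / p)\<close>, that is \<open>n \<le> const * N powr (2 - 2 / p)\<close>. As
  \<open>2 - 2 / p < 1\<close>, there are blocks for which \<open>n\<close> exceeds every multiple of \<open>N powr (2 - 2 / p)\<close>.
  Multiplying these blocks by independent signs glues them together in the \<open>l\<^sub>2\<close> sense: the upper
  estimate is orthogonality in \<open>L\<^sub>2\<close>, the lower one is Khinchine's inequality together with the
  Cauchy--Schwarz inequality in \<open>L\<^sub>1\<close>.
\<close>

section \<open>Averages over signs\<close>

text \<open>At \<open>p = 2\<close> the count in the overview yields only
  \<open>n <= const * N\<close>, which is no contradiction. For \<open>p < 2\<close> an atom is
  smaller in \<open>Lp\<close> than in L2, while the span of the columns keeps L2-type norms, and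
  the exponent drops below 1: this gap is what defeats the projections. A single block spans a
  finite-dimensional, hence complemented, space. So infinitely many blocks are needed, whose
  projection constants grow without bound. Placing them on disjoint pieces of the interval would
  combine their norms in the l_p sense and destroy the Hilbertian structure. Therefore every block
  lives on the whole interval, and only the extra signs decouple them; the blocks themselves may
  depend on each other. Lower bounds are proved for first moments and upper bounds for second
  moments, and elementary pointwise inequalities carry both to every \<open>p\<close> in between.
  Hence the isomorphism constants 1/80 and 10 do not depend on \<open>p\<close>. Block sizes are
  governed by one fact: for each fixed integer vector, each of the two ways in which a random matrix
  can fail has probability at most \<open>(9 / 10) ^ N\<close>.\<close>

definition signs :: "'i set \<Rightarrow> ('i \<Rightarrow> real) set" where
  "signs S = PiE S (\<lambda>_. {-1, 1})"

definition savg :: "'i set \<Rightarrow> (('i \<Rightarrow> real) \<Rightarrow> real) \<Rightarrow> real" where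
  "savg S g = (\<Sum>a\<in>signs S. g a) / 2 ^ card S"

lemma finite_signs [simp]: "finite S \<Longrightarrow> finite (signs S)"
  by (simp add: signs_def finite_PiE)

lemma card_signs: "finite S \<Longrightarrow> card (signs S) = 2 ^ card S"
  by (simp add: signs_def card_PiE card_insert_if numeral_2_eq_2)

lemma signs_abs [simp]: "a \<in> signs S \<Longrightarrow> k \<in> S \<Longrightarrow> \<bar>a k\<bar> = 1"
  by (auto simp: signs_def PiE_iff)

lemma signs_square [simp]: "a \<in> signs S \<Longrightarrow> k \<in> S \<Longrightarrow> a k * a k = 1"
  by (auto simp: signs_def PiE_iff)

lemma savg_empty [simp]: "savg {} g = g (\<lambda>_. undefined)"
  by (simp add: savg_def signs_def)

lemma sum_signs_insert:
  assumes "finite S" "k \<notin> S"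
  shows "(\<Sum>a\<in>signs (insert k S). g a) = (\<Sum>a\<in>signs S. g (a(k := 1)) + g (a(k := -1)))"
proof -
  have inj: "inj_on (\<lambda>(y, g). g(k := y)) ({-1, 1} \<times> signs S)"
    unfolding signs_def by (rule inj_combinator[OF assms(2)])
  have "(\<Sum>a\<in>signs (insert k S). g a) = (\<Sum>(y, a)\<in>{-1, 1} \<times> signs S. g (a(k := y)))"
    using sum.reindex[OF inj, of g] by (simp add: signs_def PiE_insert_eq split_def)
  also have "\<dots> = (\<Sum>y\<in>{-1, 1}. \<Sum>a\<in>signs S. g (a(k := y)))"
    by (rule sum.cartesian_product [symmetric])
  finally show ?thesis
    by (simp add: sum.distrib add.commute)
qed

lemma savg_insert:
  assumes "finite S" "k \<notin> S"
  shows "savg (insert k S) g = savg S (\<lambda>a. (g (a(k := 1)) + g (a(k := -1))) / 2)"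
  using assms by (simp add: savg_def sum_signs_insert sum_divide_distrib)

lemma savg_cong:
  "(\<And>a. a \<in> signs S \<Longrightarrow> f a = g a) \<Longrightarrow> savg S f = savg S g"
  unfolding savg_def by (intro arg_cong[where f="\<lambda>t. t / _"] sum.cong) auto

lemma savg_mono:
  "(\<And>a. a \<in> signs S \<Longrightarrow> f a \<le> g a) \<Longrightarrow> savg S f \<le> savg S g"
  unfolding savg_def by (intro divide_right_mono sum_mono) auto

lemma savg_add: "savg S (\<lambda>a. f a + g a) = savg S f + savg S g"
  by (simp add: savg_def sum.distrib add_divide_distrib)

lemma savg_diff: "savg S (\<lambda>a. f a - g a) = savg S f - savg S g"
  by (simp add: savg_def sum_subtractf diff_divide_distrib)

lemma savg_cmult: "savg S (\<lambda>a. c * f a) = c * savg S f"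
  by (simp add: savg_def sum_distrib_left)

lemma savg_divide: "savg S (\<lambda>a. f a / c) = savg S f / c"
  by (simp add: savg_def sum_divide_distrib mult.commute)

lemma savg_sum: "savg S (\<lambda>a. \<Sum>i\<in>I. f i a) = (\<Sum>i\<in>I. savg S (f i))"
  unfolding savg_def by (subst sum.swap) (simp add: sum_divide_distrib)

lemma savg_const: "finite S \<Longrightarrow> savg S (\<lambda>_. c) = c"
  by (simp add: savg_def card_signs)

text \<open>Fubini on the sign cube. Off \<open>S\<close> and \<open>T\<close> the merged vector
  takes the value \<open>a j\<close>, which is \<open>undefined\<close>, so it is again
  extensional.\<close>

lemma savg_Un:
  assumes "finite S" "finite T" "S \<inter> T = {}"
  shows "savg (S \<union> T) g = savg S (\<lambda>a. savg T (\<lambda>b. g (\<lambda>j. if j \<in> T then b j else a j)))"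
  using assms(2,3)
proof (induction T arbitrary: g rule: finite_induct)
  case (insert t T)
  have "savg (S \<union> insert t T) g = savg (insert t (S \<union> T)) g"
    by simp
  also have "\<dots> = savg (S \<union> T) (\<lambda>a. (g (a(t := 1)) + g (a(t := -1))) / 2)"
    using insert assms(1) by (intro savg_insert) auto
  also have "\<dots> = savg S (\<lambda>a. savg T (\<lambda>b. (g ((\<lambda>j. if j \<in> T then b j else a j)(t := 1)) +
      g ((\<lambda>j. if j \<in> T then b j else a j)(t := -1))) / 2))"
    using insert by (subst insert.IH) auto
  also have "\<dots> = savg S (\<lambda>a. savg T (\<lambda>b.
      (g (\<lambda>j. if j \<in> insert t T then (b(t := 1)) j else a j) +
      g (\<lambda>j. if j \<in> insert t T then (b(t := -1)) j else a j)) / 2))"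
  proof -
    have "((\<lambda>j. if j \<in> T then b j else a j)(t := c)) =
      (\<lambda>j. if j \<in> insert t T then (b(t := c)) j else a j)" for a b :: "'a \<Rightarrow> real" and c
      using insert by auto
    then show ?thesis
      by presburger
  qed
  also have "\<dots> = savg S (\<lambda>a. savg (insert t T) (\<lambda>b. g (\<lambda>j. if j \<in> insert t T then b j else a j)))"
    using insert by (subst savg_insert) auto
  finally show ?case .
qed auto

text \<open>The signs outside \<open>T\<close> average out. The blocks use different digit sets
  \<open>evens (m b)\<close>; this turns their averages into averages over one common set.\<close>

lemma savg_restrict:
  assumes "finite S" "T \<subseteq> S"
  shows "savg S (\<lambda>a. g (restrict a T)) = savg T g"
proof -
  have "finite T"
    using assms finite_subset by auto
  have "savg S (\<lambda>a. g (restrict a T)) = savg (T \<union> (S - T)) (\<lambda>a. g (restrict a T))"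
    using assms by (simp add: Un_absorb1)
  also have "\<dots> = savg T (\<lambda>a. savg (S - T) (\<lambda>b. g (restrict (\<lambda>j. if j \<in> S - T then b j else a j) T)))"
    using assms \<open>finite T\<close> by (intro savg_Un) auto
  also have "\<dots> = savg T (\<lambda>a. savg (S - T) (\<lambda>b. g a))"
  proof (rule savg_cong)
    fix a assume a: "a \<in> signs T"
    have "restrict (\<lambda>j. if j \<in> S - T then b j else a j) T = a" for b
      using a by (auto simp: restrict_def signs_def PiE_iff extensional_def)
    then show "savg (S - T) (\<lambda>b. g (restrict (\<lambda>j. if j \<in> S - T then b j else a j) T)) =
        savg (S - T) (\<lambda>b. g a)"
      by simp
  qed
  also have "\<dots> = savg T g"
    using assms by (simp add: savg_const)
  finally show ?thesis .
qed

lemma sum_fun_upd_other: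
  assumes "k \<notin> S"
  shows "(\<Sum>j\<in>S. v j * (a(k := c)) j) = (\<Sum>j\<in>S. v j * a j)"
  using assms by (intro sum.cong) auto

section \<open>Second and fourth moments of sign sums, and Khinchine's inequality\<close>

lemma savg_sum_square:
  assumes "finite S"
  shows "savg S (\<lambda>a. (\<Sum>k\<in>S. v k * a k)\<^sup>2) = (\<Sum>k\<in>S. (v k)\<^sup>2)"
  using assms
proof (induction S rule: finite_induct)
  case (insert t T)
  have e: "((v t + s)\<^sup>2 + (- v t + s)\<^sup>2) / 2 = s\<^sup>2 + (v t)\<^sup>2" for s
    by (simp add: power2_eq_square algebra_simps)
  have "savg (insert t T) (\<lambda>a. (\<Sum>k\<in>insert t T. v k * a k)\<^sup>2) =
      savg T (\<lambda>a. ((v t + (\<Sum>k\<in>T. v k * a k))\<^sup>2 + (- v t + (\<Sum>k\<in>T. v k * a k))\<^sup>2) / 2)"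
    using insert by (simp add: savg_insert sum_fun_upd_other del: fun_upd_apply) simp
  then show ?case
    unfolding e using insert by (simp add: savg_add savg_const)
qed simp

text \<open>Averaging over the new sign kills the odd powers of \<open>v t\<close>. Raising the
  coefficient of \<open>(v t) ^ 4\<close> from 1 to 3 then completes the square. The constant 3 is
  the fourth moment of a standard Gaussian variable.\<close>

lemma savg_sum_fourth_le:
  assumes "finite S"
  shows "savg S (\<lambda>a. (\<Sum>k\<in>S. v k * a k) ^ 4) \<le> 3 * (\<Sum>k\<in>S. (v k)\<^sup>2)\<^sup>2"
  using assms
proof (induction S rule: finite_induct)
  case (insert t T)
  have e: "((v t + s) ^ 4 + (- v t + s) ^ 4) / 2 = s ^ 4 + 6 * (v t)\<^sup>2 * s\<^sup>2 + (v t) ^ 4" for s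
    by (simp add: power2_eq_square power4_eq_xxxx algebra_simps)
  have "savg (insert t T) (\<lambda>a. (\<Sum>k\<in>insert t T. v k * a k) ^ 4) =
      savg T (\<lambda>a. ((v t + (\<Sum>k\<in>T. v k * a k)) ^ 4 + (- v t + (\<Sum>k\<in>T. v k * a k)) ^ 4) / 2)"
    using insert by (simp add: savg_insert sum_fun_upd_other del: fun_upd_apply) simp
  also have "\<dots> = savg T (\<lambda>a. (\<Sum>k\<in>T. v k * a k) ^ 4) +
      6 * (v t)\<^sup>2 * (\<Sum>k\<in>T. (v k)\<^sup>2) + (v t) ^ 4"
    unfolding e using insert by (simp add: savg_add savg_cmult savg_const savg_sum_square)
  also have "\<dots> \<le> 3 * (\<Sum>k\<in>T. (v k)\<^sup>2)\<^sup>2 + 6 * (v t)\<^sup>2 * (\<Sum>k\<in>T. (v k)\<^sup>2) + 3 * (v t) ^ 4"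
    using insert.IH zero_le_even_power'[of "v t" 2] by (simp add: numeral_eq_Suc)
  also have "\<dots> = 3 * (\<Sum>k\<in>insert t T. (v k)\<^sup>2)\<^sup>2"
    using insert by (simp add: power2_eq_square power4_eq_xxxx algebra_simps)
  finally show ?case .
qed simp

text \<open>The averages of \<open>t\<^sup>2\<close> and \<open>t ^ 4\<close> are explicit, so this pointwise bound yields Khinchine's inequality.\<close>

lemma abs_ge_quartic:
  fixes t s :: real
  assumes "0 < s"
  shows "3 / (4 * s) * t\<^sup>2 - t ^ 4 / (16 * s ^ 3) \<le> \<bar>t\<bar>"
proof -
  define u where "u = \<bar>t\<bar> / s"
  have u: "0 \<le> u" and tu: "\<bar>t\<bar> = u * s"
    using assms by (auto simp: u_def)
  \<comment> \<open>The double root makes the quartic tangent to the absolute value at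
    \<open>u = 2\<close>. Tangency at \<open>sqrt 3\<close> would optimise Khinchine's constant to
    \<open>1 / sqrt 3\<close>; the choice 2 keeps it rational and still gives 9/16.\<close>
  have "16 * u - 12 * u\<^sup>2 + u ^ 4 = u * (u - 2)\<^sup>2 * (u + 4)"
    by (simp add: power2_eq_square power4_eq_xxxx algebra_simps)
  also have "\<dots> \<ge> 0"
    using u by simp
  finally have "3 / 4 * u\<^sup>2 - u ^ 4 / 16 \<le> u"
    by simp
  then have "(3 / 4 * u\<^sup>2 - u ^ 4 / 16) * s \<le> u * s"
    using assms by (intro mult_right_mono) auto
  moreover have "3 / (4 * s) * t\<^sup>2 - t ^ 4 / (16 * s ^ 3) = (3 / 4 * u\<^sup>2 - u ^ 4 / 16) * s"
  proof -
    have "t\<^sup>2 = (u * s)\<^sup>2" "t ^ 4 = (u * s) ^ 4"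
      using tu by (metis power2_abs, metis power_even_abs_numeral even_numeral)
    then show ?thesis
      using assms by (simp add: power2_eq_square power3_eq_cube power4_eq_xxxx field_simps)
  qed
  ultimately show ?thesis
    by (simp add: tu)
qed

text \<open>The quartic minorant is scaled by the L2 norm \<open>s\<close> of the sum. The second
  moment contributes \<open>3 / 4 * s\<close>, and the fourth costs at most
  \<open>3 / 16 * s\<close>.\<close>

lemma khinchine_lower:
  assumes "finite S"
  shows "9 / 16 * sqrt (\<Sum>k\<in>S. (v k)\<^sup>2) \<le> savg S (\<lambda>a. \<bar>\<Sum>k\<in>S. v k * a k\<bar>)"
proof (cases "(\<Sum>k\<in>S. (v k)\<^sup>2) = 0")
  case True
  have "savg S (\<lambda>_. 0) \<le> savg S (\<lambda>a. \<bar>\<Sum>k\<in>S. v k * a k\<bar>)"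
    by (rule savg_mono) simp
  then show ?thesis
    unfolding True by (simp add: savg_const assms)
next
  case False
  define s where "s = sqrt (\<Sum>k\<in>S. (v k)\<^sup>2)"
  have s: "0 < s" "(\<Sum>k\<in>S. (v k)\<^sup>2) = s\<^sup>2"
    using False sum_nonneg[of S "\<lambda>k. (v k)\<^sup>2"] by (auto simp: s_def less_le)
  have "9 / 16 * s = 3 / (4 * s) * s\<^sup>2 - (3 * (s\<^sup>2)\<^sup>2) / (16 * s ^ 3)"
    using s by (simp add: power2_eq_square power3_eq_cube field_simps)
  also have "\<dots> \<le> 3 / (4 * s) * s\<^sup>2 - savg S (\<lambda>a. (\<Sum>k\<in>S. v k * a k) ^ 4) / (16 * s ^ 3)"
    using savg_sum_fourth_le[OF assms, of v] s by (intro diff_left_mono divide_right_mono) auto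
  also have "\<dots> = savg S (\<lambda>a. 3 / (4 * s) * (\<Sum>k\<in>S. v k * a k)\<^sup>2 -
      1 / (16 * s ^ 3) * (\<Sum>k\<in>S. v k * a k) ^ 4)"
    unfolding savg_diff savg_cmult by (simp add: savg_sum_square assms s)
  also have "\<dots> \<le> savg S (\<lambda>a. \<bar>\<Sum>k\<in>S. v k * a k\<bar>)"
    using abs_ge_quartic[OF s(1)] by (intro savg_mono) simp
  finally show ?thesis
    by (simp add: s_def)
qed

section \<open>Exponential moments of squares of sign sums\<close>

lemma fact_double_ge: "2 ^ k * fact k \<le> (fact (2 * k) :: real)"
proof (induction k)
  case (Suc k)
  have "2 ^ Suc k * fact (Suc k) = (2 * real (Suc k)) * (2 ^ k * fact k)"
    by simp
  also have "\<dots> \<le> (2 * real (Suc k)) * (real (Suc (2 * k)) * fact (2 * k))"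
  proof (rule mult_left_mono)
    have "1 * (2 ^ k * fact k) \<le> real (Suc (2 * k)) * fact (2 * k)"
      using Suc by (intro mult_mono) auto
    then show "2 ^ k * fact k \<le> real (Suc (2 * k)) * fact (2 * k)"
      by simp
  qed auto
  also have "\<dots> = fact (Suc (Suc (2 * k)))"
    by (simp only: fact_Suc of_nat_mult) simp
  finally show ?case
    by simp
qed simp

text \<open>The power series compare term by term, because
  \<open>2 ^ k * fact k <= fact (2 * k)\<close>.\<close>

lemma cosh_le_exp_half_square: "cosh x \<le> exp (x\<^sup>2 / 2)" for x :: real
proof (rule sums_le)
  have e: "(\<lambda>k. if even (2 * k) then x ^ (2 * k) /\<^sub>R fact (2 * k) else 0) = (\<lambda>k. x ^ (2 * k) / fact (2 * k))"
    by (simp add: field_simps)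
  have "(\<lambda>k. if even (2 * k) then x ^ (2 * k) /\<^sub>R fact (2 * k) else 0) sums cosh x"
    by (rule sums_mono_reindex[of "\<lambda>k. 2 * k", where f = "\<lambda>n. if even n then x ^ n /\<^sub>R fact n else 0", THEN iffD2, OF _ _ cosh_converges])
      (simp_all add: strict_mono_def image_def dvd_def)
  then show "(\<lambda>k. x ^ (2 * k) / fact (2 * k)) sums cosh x"
    unfolding e .
  show "(\<lambda>k. (x\<^sup>2 / 2) ^ k /\<^sub>R fact k) sums exp (x\<^sup>2 / 2)"
    by (rule exp_converges)
  fix k
  have "x ^ (2 * k) / fact (2 * k) \<le> x ^ (2 * k) / (2 ^ k * fact k)"
      by (intro divide_left_mono fact_double_ge) (simp_all add: power_mult)
  also have "\<dots> = (x\<^sup>2 / 2) ^ k /\<^sub>R fact k"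
      unfolding power_divide power_mult [symmetric] by (simp add: field_simps)
  finally show "x ^ (2 * k) / fact (2 * k) \<le> (x\<^sup>2 / 2) ^ k /\<^sub>R fact k" .
qed

text \<open>A Gaussian variable of variance Y would give \<open>exp (\<mu> * s\<^sup>2 / (1 - 2 *
  \<mu> * Y)) / sqrt (1 - 2 * \<mu> * Y)\<close>; here the prefactor is relaxed to the exponential
  of \<open>\<mu> * Y / (1 - 2 * \<mu> * Y)\<close>. The shift \<open>s\<close> is what makes the
  induction possible: a newly exposed sign moves the centre to \<open>s + v t\<close> or
  \<open>s - v t\<close>, and the mean of the two is a \<open>cosh\<close>.\<close>

lemma savg_exp_square_le:
  assumes "finite S" "0 \<le> \<mu>" "2 * \<mu> * (\<Sum>k\<in>S. (v k)\<^sup>2) < 1"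
  shows "savg S (\<lambda>a. exp (\<mu> * (s + (\<Sum>k\<in>S. v k * a k))\<^sup>2)) \<le>
    exp (\<mu> * ((\<Sum>k\<in>S. (v k)\<^sup>2) + s\<^sup>2) / (1 - 2 * \<mu> * (\<Sum>k\<in>S. (v k)\<^sup>2)))"
  using assms(1,3)
proof (induction S arbitrary: s rule: finite_induct)
  case (insert t T)
  define Y where "Y = (\<Sum>k\<in>T. (v k)\<^sup>2)"
  have sum_eq: "(\<Sum>k\<in>insert t T. (v k)\<^sup>2) = Y + (v t)\<^sup>2"
    using insert by (simp add: Y_def)
  define D where "D = 1 - 2 * \<mu> * Y"
  have Y: "0 \<le> Y"
    by (simp add: Y_def sum_nonneg)
  have Dt: "2 * \<mu> * (v t)\<^sup>2 < D" and D: "0 < D" "D \<le> 1"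
  proof -
    show 1: "2 * \<mu> * (v t)\<^sup>2 < D"
      using insert by (simp add: D_def Y_def algebra_simps)
    have "0 \<le> 2 * \<mu> * (v t)\<^sup>2" "0 \<le> \<mu> * Y"
      using assms(2) Y by auto
    with 1 show "0 < D" "D \<le> 1"
      by (auto simp: D_def mult.commute)
  qed
  have IH: "savg T (\<lambda>a. exp (\<mu> * (s + (\<Sum>k\<in>T. v k * a k))\<^sup>2)) \<le> exp (\<mu> * (Y + s\<^sup>2) / D)" for s
    using insert.IH[of s] D by (simp add: Y_def D_def)
  \<comment> \<open>The effective parameter once the signs in \<open>T\<close> have been averaged
    out; the new sign divides it further by \<open>1 - 2 * \<nu> * (v t)\<^sup>2\<close>, and the
    denominators multiply to the claimed one.\<close>
  define \<nu> where "\<nu> = \<mu> / D"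
  have \<nu>: "0 \<le> \<nu>" "2 * \<nu> * (v t)\<^sup>2 < 1"
    using assms(2) D Dt by (auto simp: \<nu>_def field_simps)
  have shift: "s + (v t + x) = (s + v t) + x" "s + (x - v t) = (s - v t) + x" for x
    by simp_all
  have "savg (insert t T) (\<lambda>a. exp (\<mu> * (s + (\<Sum>k\<in>insert t T. v k * a k))\<^sup>2)) =
     savg T (\<lambda>a. (exp (\<mu> * ((s + v t) + (\<Sum>k\<in>T. v k * a k))\<^sup>2) +
        exp (\<mu> * ((s - v t) + (\<Sum>k\<in>T. v k * a k))\<^sup>2)) / 2)"
    using insert by (simp add: savg_insert sum_fun_upd_other del: fun_upd_apply)
      (simp add: shift)
  also have "\<dots> = (savg T (\<lambda>a. exp (\<mu> * ((s + v t) + (\<Sum>k\<in>T. v k * a k))\<^sup>2)) +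
        savg T (\<lambda>a. exp (\<mu> * ((s - v t) + (\<Sum>k\<in>T. v k * a k))\<^sup>2))) / 2"
    by (simp add: savg_divide savg_add)
  also have "\<dots> \<le> (exp (\<nu> * (Y + (s + v t)\<^sup>2)) + exp (\<nu> * (Y + (s - v t)\<^sup>2))) / 2"
    using IH[of "s + v t"] IH[of "s - v t"] by (simp add: \<nu>_def)
  also have "\<dots> = exp (\<nu> * (Y + s\<^sup>2 + (v t)\<^sup>2)) * cosh (2 * \<nu> * s * v t)"
  proof -
    have "\<nu> * (Y + (s + v t)\<^sup>2) = \<nu> * (Y + s\<^sup>2 + (v t)\<^sup>2) + 2 * \<nu> * s * v t"
      "\<nu> * (Y + (s - v t)\<^sup>2) = \<nu> * (Y + s\<^sup>2 + (v t)\<^sup>2) + - (2 * \<nu> * s * v t)"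
      by (simp_all add: algebra_simps power2_eq_square)
    then show ?thesis
      by (simp only: exp_add) (simp add: cosh_def distrib_left)
  qed
  also have "\<dots> \<le> exp (\<nu> * (Y + s\<^sup>2 + (v t)\<^sup>2)) * exp ((2 * \<nu> * s * v t)\<^sup>2 / 2)"
    by (intro mult_left_mono cosh_le_exp_half_square) auto
  also have "\<dots> = exp (\<nu> * ((Y + (v t)\<^sup>2) + s\<^sup>2 * (1 + 2 * \<nu> * (v t)\<^sup>2)))"
    unfolding exp_add[symmetric] by (simp add: algebra_simps power2_eq_square)
  \<comment> \<open>With \<open>z = 2 * \<nu> * (v t)\<^sup>2\<close>, the bounds
    \<open>1 + z <= 1 / (1 - z)\<close> and \<open>w <= w / (1 - z)\<close> bring both summands to
    the common denominator \<open>1 - z\<close>.\<close>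
  also have "\<dots> \<le> exp (\<nu> * ((Y + (v t)\<^sup>2) / (1 - 2 * \<nu> * (v t)\<^sup>2) + s\<^sup>2 * (1 / (1 - 2 * \<nu> * (v t)\<^sup>2))))"
  proof -
    have z: "1 + z \<le> 1 / (1 - z)" "w \<le> w / (1 - z)" if "0 \<le> z" "z < 1" "0 \<le> w" for z w :: real
      using that by (auto simp: field_simps mult_nonneg_nonneg)
    have nn: "0 \<le> 2 * \<nu> * (v t)\<^sup>2"
      using \<nu> by simp
    show ?thesis
      unfolding exp_le_cancel_iff
      using \<nu> Y nn by (intro mult_left_mono add_mono z) auto
  qed
  also have "\<nu> * ((Y + (v t)\<^sup>2) / (1 - 2 * \<nu> * (v t)\<^sup>2) + s\<^sup>2 * (1 / (1 - 2 * \<nu> * (v t)\<^sup>2))) =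
      \<mu> * ((Y + (v t)\<^sup>2) + s\<^sup>2) / (D * (1 - 2 * \<nu> * (v t)\<^sup>2))"
    using D by (simp add: \<nu>_def add_divide_distrib[symmetric])
  also have "D * (1 - 2 * \<nu> * (v t)\<^sup>2) = 1 - 2 * \<mu> * (Y + (v t)\<^sup>2)"
    using D by (simp add: \<nu>_def right_diff_distrib) (simp add: D_def algebra_simps)
  finally show ?case
    unfolding sum_eq .
qed simp

section \<open>Random sign matrices\<close>

text \<open>The probabilistic method. The rows \<open>M i\<close> are drawn independently, so the
  mean of each product is at most \<open>q ^ card I\<close>; by Markov's inequality and the union
  bound, the matrices that violate some \<open>z\<close> cannot be all of them.\<close>

lemma ex_all_prod_less_one:
  fixes \<phi> :: "'z \<Rightarrow> ('k \<Rightarrow> real) \<Rightarrow> real"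
  assumes fin: "finite Z" "finite I" "finite S"
    and nonneg: "\<And>z a. 0 \<le> \<phi> z a"
    and le: "\<And>z. z \<in> Z \<Longrightarrow> savg S (\<phi> z) \<le> q"
    and small: "real (card Z) * q ^ card I < 1"
  obtains M where "M \<in> PiE I (\<lambda>_. signs S)" "\<And>z. z \<in> Z \<Longrightarrow> (\<Prod>i\<in>I. \<phi> z (M i)) < 1"
proof -
  define D where "D = (2 :: real) ^ card S"
  have D: "0 < D" "D = real (card (signs S))"
    using fin by (auto simp: D_def card_signs)
  have sum_prod: "(\<Sum>M\<in>PiE I (\<lambda>_. signs S). \<Prod>i\<in>I. \<phi> z (M i)) \<le> (D * q) ^ card I" if "z \<in> Z" for z
  proof -
    have "(\<Sum>M\<in>PiE I (\<lambda>_. signs S). \<Prod>i\<in>I. \<phi> z (M i)) = (\<Prod>i\<in>I. \<Sum>a\<in>signs S. \<phi> z a)"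
      using fin by (intro prod_sum_PiE [symmetric]) auto
    also have "\<dots> = (D * savg S (\<phi> z)) ^ card I"
      using fin D by (simp add: savg_def D_def)
    also have "\<dots> \<le> (D * q) ^ card I"
      using that D le nonneg by (intro power_mono mult_left_mono mult_nonneg_nonneg)
        (auto simp: savg_def intro!: divide_nonneg_nonneg sum_nonneg)
    finally show ?thesis .
  qed
  have "\<exists>M\<in>PiE I (\<lambda>_. signs S). \<forall>z\<in>Z. (\<Prod>i\<in>I. \<phi> z (M i)) < 1"
  proof (rule ccontr)
    assume neg: "\<not> ?thesis"
    have "D ^ card I = (\<Sum>M\<in>PiE I (\<lambda>_. signs S). 1)"
      using fin D by (simp add: card_PiE)
    also have "\<dots> \<le> (\<Sum>M\<in>PiE I (\<lambda>_. signs S). \<Sum>z\<in>Z. \<Prod>i\<in>I. \<phi> z (M i))"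
    proof (rule sum_mono)
      fix M assume "M \<in> PiE I (\<lambda>_. signs S)"
      with neg obtain z where z: "z \<in> Z" "1 \<le> (\<Prod>i\<in>I. \<phi> z (M i))"
        by (auto simp: not_less)
      note z(2)
      also have "(\<Prod>i\<in>I. \<phi> z (M i)) \<le> (\<Sum>z\<in>Z. \<Prod>i\<in>I. \<phi> z (M i))"
        using z fin nonneg by (intro member_le_sum prod_nonneg) auto
      finally show "1 \<le> (\<Sum>z\<in>Z. \<Prod>i\<in>I. \<phi> z (M i))" .
    qed
    also have "\<dots> = (\<Sum>z\<in>Z. \<Sum>M\<in>PiE I (\<lambda>_. signs S). \<Prod>i\<in>I. \<phi> z (M i))"
      by (rule sum.swap)
    also have "\<dots> \<le> (\<Sum>z\<in>Z. (D * q) ^ card I)"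
      by (intro sum_mono sum_prod)
    also have "\<dots> = D ^ card I * (real (card Z) * q ^ card I)"
      by (simp add: power_mult_distrib)
    also have "\<dots> < D ^ card I * 1"
      using D small by (intro mult_strict_left_mono) auto
    finally show False
      by simp
  qed
  with that show thesis by auto
qed

text \<open>The quadratic Taylor polynomials of exp at \<open>w\<close> and at \<open>- w\<close>
  multiply to \<open>1 + w ^ 4 / 4\<close>, and the first of them is at most
  \<open>exp w\<close>.\<close>

lemma exp_minus_le_quadratic:
  fixes w :: real
  assumes "0 \<le> w"
  shows "exp (- w) \<le> 1 - w + w\<^sup>2 / 2"
proof -
  have "1 \<le> 1 + w ^ 4 / 4"
    by simp
  also have "\<dots> = (1 - w + w\<^sup>2 / 2) * (1 + w + w\<^sup>2 / 2)"
    by (simp add: power2_eq_square power4_eq_xxxx algebra_simps)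
  also have "\<dots> \<le> (1 - w + w\<^sup>2 / 2) * exp w"
  proof (intro mult_left_mono)
    show "1 + w + w\<^sup>2 / 2 \<le> exp w"
      using exp_lower_Taylor_quadratic[OF assms] by simp
    have "0 \<le> ((w - 1)\<^sup>2 + 1) / 2"
      by simp
    also have "\<dots> = 1 - w + w\<^sup>2 / 2"
      by (simp add: power2_eq_square algebra_simps add_divide_distrib diff_divide_distrib)
    finally show "0 \<le> 1 - w + w\<^sup>2 / 2" .
  qed
  finally show ?thesis
    by (simp add: exp_minus field_simps)
qed

text \<open>When the product of these factors over the rows is below 1, the mean of the absolute row
  sums exceeds 1/10. The quadratic bound and Khinchine's inequality give
  \<open>1 - 9/32 + 1/8 = 27/32\<close>, which leaves room for the factor
  \<open>exp (1 / 20)\<close>.\<close>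

lemma savg_exp_minus_abs_le:
  assumes "finite S" "(\<Sum>k\<in>S. (u k)\<^sup>2) = 1"
  shows "savg S (\<lambda>a. exp (1 / 20 - \<bar>\<Sum>k\<in>S. u k * a k\<bar> / 2)) \<le> 9 / 10"
proof -
  let ?t = "\<lambda>a. \<Sum>k\<in>S. u k * a k"
  have "savg S (\<lambda>a. exp (1 / 20 - \<bar>?t a\<bar> / 2)) = exp (1 / 20) * savg S (\<lambda>a. exp (- (\<bar>?t a\<bar> / 2)))"
    by (simp add: savg_cmult[symmetric] exp_add[symmetric])
  also have "\<dots> \<le> exp (1 / 20) * savg S (\<lambda>a. 1 - 1 / 2 * \<bar>?t a\<bar> + 1 / 8 * (?t a)\<^sup>2)"
  proof (intro mult_left_mono savg_mono)
    fix a
    show "exp (- (\<bar>?t a\<bar> / 2)) \<le> 1 - 1 / 2 * \<bar>?t a\<bar> + 1 / 8 * (?t a)\<^sup>2"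
      using exp_minus_le_quadratic[of "\<bar>?t a\<bar> / 2"] by (simp add: power_divide)
  qed auto
  also have "\<dots> = exp (1 / 20) * (9 / 8 - 1 / 2 * savg S (\<lambda>a. \<bar>?t a\<bar>))"
    unfolding savg_add savg_diff savg_cmult by (simp add: savg_const savg_sum_square assms)
  also have "\<dots> \<le> exp (1 / 20) * (27 / 32)"
    using khinchine_lower[OF assms(1), of u] assms(2) by (intro mult_left_mono) auto
  also have "exp (1 / 20) \<le> (20 / 19 :: real)"
    using exp_ge_add_one_self[of "- (1 / 20) :: real"] by (simp add: exp_minus field_simps)
  finally show ?thesis
    by simp
qed

text \<open>The counterpart for the upper estimate: a product over the rows below 1 means that the
  squared row sums have mean below 4. It is stated with the same bound 9/10, so that one union bound
  serves both estimates.\<close>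

lemma savg_exp_square_minus_le:
  assumes "finite S" "(\<Sum>k\<in>S. (u k)\<^sup>2) = 1"
  shows "savg S (\<lambda>a. exp ((\<Sum>k\<in>S. u k * a k)\<^sup>2 / 4 - 1)) \<le> 9 / 10"
proof -
  have "savg S (\<lambda>a. exp ((\<Sum>k\<in>S. u k * a k)\<^sup>2 / 4 - 1)) =
      exp (- 1) * savg S (\<lambda>a. exp (1 / 4 * (0 + (\<Sum>k\<in>S. u k * a k))\<^sup>2))"
    unfolding savg_cmult[symmetric] exp_add[symmetric] by simp
  also have "\<dots> \<le> exp (- 1) * exp (1 / 2)"
    using savg_exp_square_le[OF assms(1), of "1/4" u 0] assms by (intro mult_left_mono) auto
  also have "\<dots> = exp (- (1 / 2) :: real)"
    by (simp add: exp_add[symmetric])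
  also have "\<dots> \<le> 9 / 10"
    using exp_ge_add_one_self[of "1 / 2 :: real"] by (simp add: exp_minus field_simps)
  finally show ?thesis .
qed

text \<open>The union bound runs over at most \<open>(2 * m + 1) ^ n\<close> integer vectors, and
  the factor 2 counts the two estimates demanded of each.\<close>

lemma ex_sign_matrix_integer:
  fixes I :: "'i set" and n :: nat and m :: int
  assumes "finite I" "0 \<le> m" "2 * (2 * m + 1) ^ n * (9 / 10 :: real) ^ card I < 1"
  obtains A :: "'i \<Rightarrow> nat \<Rightarrow> real" where
    "\<And>i. i \<in> I \<Longrightarrow> A i \<in> signs {..<n}"
    "\<forall>z s. (\<forall>k<n. \<bar>z k\<bar> \<le> m) \<longrightarrow> 0 < s \<longrightarrow> s\<^sup>2 = (\<Sum>k<n. (real_of_int (z k))\<^sup>2) \<longrightarrow>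
       real (card I) * s / 10 < (\<Sum>i\<in>I. \<bar>\<Sum>k<n. z k * A i k\<bar>) \<and>
       (\<Sum>i\<in>I. (\<Sum>k<n. z k * A i k)\<^sup>2) < 4 * real (card I) * s\<^sup>2"
proof -
  define S where "S = {..<n}"
  define N where "N = real (card I)"
  define nrm where "nrm z = sqrt (\<Sum>k\<in>S. (real_of_int (z k))\<^sup>2)" for z :: "nat \<Rightarrow> int"
  define t where "t z a = (\<Sum>k\<in>S. z k / nrm z * a k)" for z :: "nat \<Rightarrow> int" and a :: "nat \<Rightarrow> real"
  define Z where "Z = {z \<in> PiE S (\<lambda>_. {-m..m}). 0 < nrm z}"
  \<comment> \<open>The Boolean selects the estimate: \<open>True\<close> the lower bound on first
    moments, \<open>False\<close> the upper bound on second moments.\<close>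
  define \<phi> where "\<phi> = (\<lambda>(b, z) a. if b then exp (1 / 20 - \<bar>t z a\<bar> / 2) else exp ((t z a)\<^sup>2 / 4 - 1))"
  have "card Z \<le> card (PiE S (\<lambda>_. {-m..m}))"
    unfolding Z_def by (intro card_mono finite_PiE) (auto simp: S_def)
  also have "\<dots> = nat (2 * m + 1) ^ n"
    using assms by (simp add: card_PiE S_def)
  finally have "real (card Z) \<le> (2 * m + 1) ^ n"
    using assms(2) by (simp flip: of_nat_le_iff[where 'a = real])
  then have "real (card (UNIV \<times> Z :: (bool \<times> _) set)) * (9 / 10 :: real) ^ card I
      \<le> 2 * (2 * m + 1) ^ n * (9 / 10) ^ card I"
    by (intro mult_right_mono) (auto simp: card_cartesian_product)
  then have small: "real (card (UNIV \<times> Z :: (bool \<times> _) set)) * (9 / 10 :: real) ^ card I < 1"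
    using assms(3) by (rule le_less_trans)
  have unit: "(\<Sum>k\<in>S. (z k / nrm z)\<^sup>2) = 1" if "0 < nrm z" for z
    using that by (simp add: power_divide sum_divide_distrib[symmetric])
      (simp add: nrm_def sum_nonneg)
  have finZ: "finite (UNIV \<times> Z :: (bool \<times> _) set)"
    unfolding Z_def by (intro finite_cartesian_product finite_Collect_conjI disjI1) (auto simp: S_def intro!: finite_PiE)
  obtain M where M: "M \<in> PiE I (\<lambda>_. signs S)"
    "\<And>z. z \<in> UNIV \<times> Z \<Longrightarrow> (\<Prod>i\<in>I. \<phi> z (M i)) < 1"
  proof (rule ex_all_prod_less_one[OF finZ assms(1) _ _ _ small, of S \<phi>])
    show "finite S"
      by (simp add: S_def)
    show "0 \<le> \<phi> z a" for z a
      by (auto simp: \<phi>_def split: prod.splits)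
    show "savg S (\<phi> z) \<le> 9 / 10" if "z \<in> UNIV \<times> Z" for z
      using that savg_exp_minus_abs_le[OF \<open>finite S\<close> unit] savg_exp_square_minus_le[OF \<open>finite S\<close> unit]
      by (cases "fst z") (auto simp: \<phi>_def Z_def t_def)
  qed blast
  show thesis
  proof (rule that[of M])
    show "M i \<in> signs {..<n}" if "i \<in> I" for i
      using M(1) that by (auto simp: S_def)
  next
    show "\<forall>z s. (\<forall>k<n. \<bar>z k\<bar> \<le> m) \<longrightarrow> 0 < s \<longrightarrow> s\<^sup>2 = (\<Sum>k<n. (real_of_int (z k))\<^sup>2) \<longrightarrow>
       real (card I) * s / 10 < (\<Sum>i\<in>I. \<bar>\<Sum>k<n. z k * M i k\<bar>) \<and>
       (\<Sum>i\<in>I. (\<Sum>k<n. z k * M i k)\<^sup>2) < 4 * real (card I) * s\<^sup>2"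
    proof (intro allI impI)
      fix z :: "nat \<Rightarrow> int" and s :: real
      assume zm: "\<forall>k<n. \<bar>z k\<bar> \<le> m" and s: "0 < s" "s\<^sup>2 = (\<Sum>k<n. (real_of_int (z k))\<^sup>2)"
      \<comment> \<open>Members of \<open>Z\<close> are extensional, whereas \<open>z\<close> is
        arbitrary from \<open>n\<close> on.\<close>
      define z' where "z' = restrict z S"
      have nz: "nrm z' = s"
        using s by (simp add: nrm_def z'_def S_def) (metis less_le real_sqrt_unique)
      have "z' \<in> Z"
        using zm s(1) nz by (auto simp: Z_def z'_def S_def abs_le_iff minus_le_iff)
      have tz: "t z' a = (\<Sum>k<n. z k * a k) / s" for a :: "nat \<Rightarrow> real"
        by (simp add: t_def nz sum_divide_distrib) (simp add: z'_def S_def)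
      have "exp (\<Sum>i\<in>I. 1 / 20 - \<bar>t z' (M i)\<bar> / 2) < 1" "exp (\<Sum>i\<in>I. (t z' (M i))\<^sup>2 / 4 - 1) < 1"
        using M(2)[of "(True, z')"] M(2)[of "(False, z')"] \<open>z' \<in> Z\<close> assms(1)
        by (auto simp: \<phi>_def exp_sum)
      then have "N / 20 < (\<Sum>i\<in>I. \<bar>t z' (M i)\<bar>) / 2" "(\<Sum>i\<in>I. (t z' (M i))\<^sup>2) / 4 < N"
        by (simp_all add: sum_subtractf N_def sum_divide_distrib)
      moreover have "(\<Sum>i\<in>I. \<bar>t z' (M i)\<bar>) = (\<Sum>i\<in>I. \<bar>\<Sum>k<n. z k * M i k\<bar>) / s"
        unfolding tz abs_divide sum_divide_distrib [symmetric] using s(1) by simp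
      moreover have "(\<Sum>i\<in>I. (t z' (M i))\<^sup>2) = (\<Sum>i\<in>I. (\<Sum>k<n. z k * M i k)\<^sup>2) / s\<^sup>2"
        unfolding tz power_divide sum_divide_distrib [symmetric] ..
      ultimately show "real (card I) * s / 10 < (\<Sum>i\<in>I. \<bar>\<Sum>k<n. z k * M i k\<bar>) \<and>
         (\<Sum>i\<in>I. (\<Sum>k<n. z k * M i k)\<^sup>2) < 4 * real (card I) * s\<^sup>2"
        using s(1) by (simp add: N_def field_simps)
    qed
  qed
qed

text \<open>
  Since \<open>n log n\<close> is small against the number of rows, the union bound affords the crude net of
  integer vectors \<open>\<lfloor>22 * n * x\<rfloor>\<close>; rounding then moves each row sum by at most \<open>n\<close>.
\<close>

lemma ex_sign_matrix:
  fixes I :: "'i set" and n :: nat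
  assumes "finite I" "1 \<le> n" "2 * (45 * real n) ^ n * (9 / 10 :: real) ^ card I < 1"
  obtains A :: "'i \<Rightarrow> nat \<Rightarrow> real" where
    "\<forall>i\<in>I. A i \<in> signs {..<n}"
    "\<forall>x. real (card I) * sqrt (\<Sum>k<n. (x k)\<^sup>2) \<le> 20 * (\<Sum>i\<in>I. \<bar>\<Sum>k<n. x k * A i k\<bar>)"
    "\<forall>x. (\<Sum>i\<in>I. (\<Sum>k<n. x k * A i k)\<^sup>2) \<le> 17 * real (card I) * (\<Sum>k<n. (x k)\<^sup>2)"
proof -
  \<comment> \<open>The mesh 22 fixes the constants. The net needs
    \<open>2 * m + 1 <= 45 * n\<close> values per coordinate. Rounding leaves
    \<open>s >= 21 * n\<close> and an error of at most \<open>n\<close> per row, so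
    \<open>21/10 * n - n = 11/10 * n\<close> survives, and division by \<open>22 * n\<close> gives
    1/20.\<close>
  define m where "m = int (22 * n)"
  define N where "N = real (card I)"
  have m_nonneg: "0 \<le> m" and "0 \<le> N"
    by (simp_all add: m_def N_def)
  have "(2 * real_of_int m + 1) ^ n \<le> (45 * real n) ^ n"
    using assms(2) by (intro power_mono) (auto simp: m_def)
  then have "2 * (2 * m + 1) ^ n * (9 / 10 :: real) ^ card I \<le> 2 * (45 * real n) ^ n * (9 / 10 :: real) ^ card I"
    by (simp add: mult_right_mono)
  then have "2 * (2 * m + 1) ^ n * (9 / 10 :: real) ^ card I < 1"
    using assms(3) by (rule le_less_trans)
  then obtain A :: "'i \<Rightarrow> nat \<Rightarrow> real" where A: "\<And>i. i \<in> I \<Longrightarrow> A i \<in> signs {..<n}"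
    and Az: "\<forall>z s. (\<forall>k<n. \<bar>z k\<bar> \<le> m) \<longrightarrow> 0 < s \<longrightarrow> s\<^sup>2 = (\<Sum>k<n. (real_of_int (z k))\<^sup>2) \<longrightarrow>
       real (card I) * s / 10 < (\<Sum>i\<in>I. \<bar>\<Sum>k<n. z k * A i k\<bar>) \<and>
       (\<Sum>i\<in>I. (\<Sum>k<n. z k * A i k)\<^sup>2) < 4 * real (card I) * s\<^sup>2"
    by (rule ex_sign_matrix_integer[OF assms(1) m_nonneg]) (rule that)
  note Az = Az [folded N_def]
  have unit: "N \<le> 20 * (\<Sum>i\<in>I. \<bar>\<Sum>k<n. x k * A i k\<bar>) \<and>
      (\<Sum>i\<in>I. (\<Sum>k<n. x k * A i k)\<^sup>2) \<le> 17 * N" if x: "(\<Sum>k<n. (x k)\<^sup>2) = 1" for x :: "nat \<Rightarrow> real"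
  proof -
    define z where "z k = \<lfloor>m * x k\<rfloor>" for k
    define s where "s = sqrt (\<Sum>k<n. (real_of_int (z k))\<^sup>2)"
    have x1: "\<bar>x k\<bar> \<le> 1" if "k < n" for k
    proof -
      have "(x k)\<^sup>2 \<le> (\<Sum>k<n. (x k)\<^sup>2)"
        using that by (intro member_le_sum) auto
      then show ?thesis
        using x abs_square_le_1[of "x k"] by simp
    qed
    have zx: "\<bar>z k - m * x k\<bar> \<le> 1" for k
      unfolding z_def by linarith
    have zm: "\<bar>z k\<bar> \<le> m" if "k < n" for k
    proof -
      have "\<bar>m * x k\<bar> \<le> m"
        using x1[OF that] by (simp add: abs_mult m_def mult_left_le)
      then show ?thesis
        unfolding z_def abs_le_iff by (auto simp: floor_le_iff le_floor_iff) linarith+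
    qed
    \<comment> \<open>Rounding cannot shorten the vector much. Pair \<open>m * x\<close> with the
      unit vector \<open>x\<close>: the integer part contributes at most \<open>s\<close> by
      Cauchy-Schwarz, and the rounding error at most 1 per coordinate.\<close>
    have sm: "22 * real n \<le> s + n"
    proof -
      have "22 * real n = m * (\<Sum>k<n. (x k)\<^sup>2)"
        using x by (simp add: m_def)
      also have "\<dots> = (\<Sum>k<n. x k * (m * x k))"
        by (simp add: sum_distrib_left power2_eq_square mult_ac)
      also have "\<dots> = (\<Sum>k<n. x k * z k) + (\<Sum>k<n. x k * (m * x k - z k))"
        by (simp add: sum.distrib[symmetric] algebra_simps)
      also have "\<dots> \<le> s + (\<Sum>k<n. 1)"
      proof (intro add_mono sum_mono)
        have "(\<Sum>k<n. x k * z k) \<le> (\<Sum>k<n. \<bar>x k\<bar> * \<bar>real_of_int (z k)\<bar>)"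
          by (intro sum_mono) (metis abs_ge_self abs_mult)
        also have "\<dots> \<le> L2_set x {..<n} * L2_set (\<lambda>k. z k) {..<n}"
          by (rule L2_set_mult_ineq)
        finally show "(\<Sum>k<n. x k * z k) \<le> s"
          using x by (simp add: L2_set_def s_def)
        fix k assume "k \<in> {..<n}"
        have "x k * (m * x k - z k) \<le> \<bar>x k\<bar> * \<bar>m * x k - z k\<bar>"
          by (metis abs_ge_self abs_mult)
        also have "\<dots> \<le> 1 * 1"
          using x1[of k] zx[of k] \<open>k \<in> {..<n}\<close> by (intro mult_mono) (auto simp: abs_minus_commute)
        finally show "x k * (m * x k - z k) \<le> 1"
          by simp
      qed
      finally show ?thesis
        by simp
    qed
    then have "0 < s"
      using assms(2) by linarith
    have s2: "s\<^sup>2 = (\<Sum>k<n. (real_of_int (z k))\<^sup>2)"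
      by (simp add: s_def sum_nonneg)
    have L1: "N * s / 10 < (\<Sum>i\<in>I. \<bar>\<Sum>k<n. z k * A i k\<bar>)"
      and L2: "(\<Sum>i\<in>I. (\<Sum>k<n. z k * A i k)\<^sup>2) < 4 * N * s\<^sup>2"
      using Az zm \<open>0 < s\<close> s2 by blast+
    have diff: "\<bar>(\<Sum>k<n. z k * A i k) - m * (\<Sum>k<n. x k * A i k)\<bar> \<le> n" if "i \<in> I" for i
    proof -
      have "(\<Sum>k<n. z k * A i k) - m * (\<Sum>k<n. x k * A i k) = (\<Sum>k<n. (z k - m * x k) * A i k)"
        by (simp add: sum_distrib_left sum_subtractf algebra_simps)
      also have "\<bar>\<dots>\<bar> \<le> (\<Sum>k<n. \<bar>(z k - m * x k) * A i k\<bar>)"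
        by (rule sum_abs)
      also have "\<dots> \<le> (\<Sum>k<n. 1)"
        using A[OF that] zx by (intro sum_mono) (simp add: abs_mult)
      finally show ?thesis
        by simp
    qed
    have "N * (21 * real n) / 10 \<le> N * s / 10"
      using sm \<open>0 \<le> N\<close> by (intro divide_right_mono mult_left_mono) auto
    also note L1
    also have "(\<Sum>i\<in>I. \<bar>\<Sum>k<n. z k * A i k\<bar>) \<le> (\<Sum>i\<in>I. m * \<bar>\<Sum>k<n. x k * A i k\<bar> + n)"
    proof (rule sum_mono)
      fix i assume "i \<in> I"
      have "\<bar>m * (\<Sum>k<n. x k * A i k)\<bar> = m * \<bar>\<Sum>k<n. x k * A i k\<bar>"
        by (simp add: abs_mult m_def)
      with diff[OF \<open>i \<in> I\<close>] show "\<bar>\<Sum>k<n. z k * A i k\<bar> \<le> m * \<bar>\<Sum>k<n. x k * A i k\<bar> + n"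
        by linarith
    qed
    also have "\<dots> = 22 * n * (\<Sum>i\<in>I. \<bar>\<Sum>k<n. x k * A i k\<bar>) + N * n"
      by (simp add: sum.distrib sum_distrib_left N_def m_def)
    finally have "real n * (N * 11 / 10) \<le> real n * (22 * (\<Sum>i\<in>I. \<bar>\<Sum>k<n. x k * A i k\<bar>))"
      by (simp add: algebra_simps)
    then have 1: "N \<le> 20 * (\<Sum>i\<in>I. \<bar>\<Sum>k<n. x k * A i k\<bar>)"
      using assms(2) by simp
    have sq: "(u + v)\<^sup>2 \<le> 2 * u\<^sup>2 + 2 * v\<^sup>2" for u v :: real
      using zero_le_power2[of "u - v"] by (simp add: power2_eq_square algebra_simps)
    have "s\<^sup>2 \<le> (\<Sum>k<n. 2 * (m * x k)\<^sup>2 + 2)"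
      unfolding s2
    proof (rule sum_mono)
      fix k
      have "(real_of_int (z k))\<^sup>2 \<le> 2 * (m * x k)\<^sup>2 + 2 * (z k - m * x k)\<^sup>2"
        using sq[of "m * x k" "z k - m * x k"] by simp
      moreover have "(z k - m * x k)\<^sup>2 \<le> 1"
        using zx[of k] by (simp add: abs_square_le_1)
      ultimately show "(real_of_int (z k))\<^sup>2 \<le> 2 * (m * x k)\<^sup>2 + 2"
        by linarith
    qed
    also have "\<dots> = 2 * m\<^sup>2 + 2 * n"
      using x by (simp add: sum.distrib power_mult_distrib sum_distrib_left[symmetric])
    finally have s2_le: "s\<^sup>2 \<le> 968 * (real n)\<^sup>2 + 2 * n"
      by (simp add: m_def power_mult_distrib)
    have "m\<^sup>2 * (\<Sum>i\<in>I. (\<Sum>k<n. x k * A i k)\<^sup>2) = (\<Sum>i\<in>I. (m * (\<Sum>k<n. x k * A i k))\<^sup>2)"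
      unfolding sum_distrib_left [of _ _ I] power_mult_distrib by simp
    also have "\<dots> \<le> (\<Sum>i\<in>I. 2 * (\<Sum>k<n. z k * A i k)\<^sup>2 + 2 * (real n)\<^sup>2)"
    proof (rule sum_mono)
      fix i assume "i \<in> I"
      define a b where "a = (\<Sum>k<n. z k * A i k)" and "b = m * (\<Sum>k<n. x k * A i k)"
      have "\<bar>b - a\<bar> \<le> \<bar>real n\<bar>"
        using diff[OF \<open>i \<in> I\<close>] by (simp add: a_def b_def abs_minus_commute)
      then have "(b - a)\<^sup>2 \<le> (real n)\<^sup>2"
        by (simp only: abs_le_square_iff)
      then show "b\<^sup>2 \<le> 2 * a\<^sup>2 + 2 * (real n)\<^sup>2"
        using sq[of a "b - a"] by simp
    qed
    also have "\<dots> = 2 * (\<Sum>i\<in>I. (\<Sum>k<n. z k * A i k)\<^sup>2) + 2 * (real n)\<^sup>2 * N"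
      by (simp add: sum.distrib sum_distrib_left N_def)
    also have "\<dots> \<le> 2 * (4 * N * (968 * (real n)\<^sup>2 + 2 * n)) + 2 * (real n)\<^sup>2 * N"
      using L2 mult_left_mono[OF s2_le, of "4 * N"] \<open>0 \<le> N\<close> by simp
    also have "\<dots> \<le> 2 * (4 * N * (968 * (real n)\<^sup>2 + 2 * (real n)\<^sup>2)) + 2 * (real n)\<^sup>2 * N"
      using assms(2) \<open>0 \<le> N\<close> by (intro add_mono mult_left_mono) (auto simp: power2_eq_square)
    \<comment> \<open>The constant 17 comes from here: \<open>2 * 4 * 970 + 2 = 7762\<close> is at
      most \<open>17 * 484\<close>, where \<open>484 * n\<^sup>2\<close> is \<open>m\<^sup>2\<close>
      and \<open>968 = 2 * 484\<close>.\<close>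
    also have "\<dots> \<le> m\<^sup>2 * (17 * N)"
      using \<open>0 \<le> N\<close> by (simp add: m_def power_mult_distrib algebra_simps)
    finally have "(\<Sum>i\<in>I. (\<Sum>k<n. x k * A i k)\<^sup>2) \<le> 17 * N"
      using assms(2) by (simp add: m_def)
    with 1 show ?thesis ..
  qed
  have gen: "N * sqrt (\<Sum>k<n. (x k)\<^sup>2) \<le> 20 * (\<Sum>i\<in>I. \<bar>\<Sum>k<n. x k * A i k\<bar>) \<and>
    (\<Sum>i\<in>I. (\<Sum>k<n. x k * A i k)\<^sup>2) \<le> 17 * N * (\<Sum>k<n. (x k)\<^sup>2)" for x :: "nat \<Rightarrow> real"
  proof (cases "(\<Sum>k<n. (x k)\<^sup>2) = 0")
    case True
    then have "\<forall>k\<in>{..<n}. x k = 0"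
      by (subst (asm) sum_nonneg_eq_0_iff) auto
    then show ?thesis
      by simp
  next
    case False
    define r where "r = sqrt (\<Sum>k<n. (x k)\<^sup>2)"
    have r: "0 < r" "r\<^sup>2 = (\<Sum>k<n. (x k)\<^sup>2)"
      using False sum_nonneg[of "{..<n}" "\<lambda>k. (x k)\<^sup>2"] by (auto simp: r_def less_le)
    have "(\<Sum>k<n. (x k / r)\<^sup>2) = 1"
      using r(1) unfolding power_divide sum_divide_distrib [symmetric] r(2) [symmetric] by simp
    from unit[OF this] have "N \<le> 20 * ((\<Sum>i\<in>I. \<bar>\<Sum>k<n. x k * A i k\<bar>) / r)"
      "(\<Sum>i\<in>I. (\<Sum>k<n. x k * A i k)\<^sup>2) / r\<^sup>2 \<le> 17 * N"
      using r by (simp_all add: sum_divide_distrib[symmetric] power_divide)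
    with r(1) show ?thesis
      unfolding r(2) [symmetric] by (simp add: field_simps)
  qed
  show thesis
    by (rule that[of A]) (use A gen in \<open>auto simp: N_def\<close>)
qed

section \<open>Rademacher functions\<close>

text \<open>Off the dyadic points this is the sign of \<open>sin (2 ^ Suc j * pi * x)\<close>.
  Reading it off the binary digit makes the halving of the interval a shift of
  \<open>j\<close>.\<close>

definition rad :: "nat \<Rightarrow> real \<Rightarrow> real" where
  "rad j x = (if even \<lfloor>2 ^ Suc j * x\<rfloor> then 1 else - 1)"

lemma rad_measurable [measurable]: "rad j \<in> borel_measurable borel"
  unfolding rad_def by measurable

lemma rad_cases: "rad j x = 1 \<or> rad j x = - 1"
  by (simp add: rad_def)

text \<open>No measurability of \<open>\<phi>\<close> is assumed: \<open>rad j\<close> has only two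
  values, so \<open>\<phi>\<close> agrees with an affine function on them.\<close>

lemma rad_compose_measurable [measurable]:
  fixes \<phi> :: "real \<Rightarrow> real"
  shows "(\<lambda>x. \<phi> (rad j x)) \<in> borel_measurable borel"
proof -
  have "\<phi> (rad j x) = (\<phi> 1 + \<phi> (- 1)) / 2 + (\<phi> 1 - \<phi> (- 1)) / 2 * rad j x" for x
    using rad_cases[of j x] by (auto simp: field_simps)
  then show ?thesis
    by simp
qed

lemma rad_0: "0 \<le> x \<Longrightarrow> x < 1 \<Longrightarrow> rad 0 (x / 2) = 1"
  "0 \<le> x \<Longrightarrow> x < 1 \<Longrightarrow> rad 0 (1 / 2 + x / 2) = - 1"
proof -
  assume x: "0 \<le> x" "x < 1"
  have "\<lfloor>x\<rfloor> = 0" "\<lfloor>1 + x\<rfloor> = 1"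
    using x by linarith+
  then show "rad 0 (x / 2) = 1" "rad 0 (1 / 2 + x / 2) = - 1"
    by (simp_all add: rad_def distrib_left)
qed

lemma rad_Suc: "rad (Suc j) (x / 2) = rad j x" "rad (Suc j) (1 / 2 + x / 2) = rad j x"
proof -
  have "2 ^ Suc (Suc j) * (x / 2) = 2 ^ Suc j * x"
    "2 ^ Suc (Suc j) * (1 / 2 + x / 2) = 2 ^ Suc j * x + of_int (2 ^ Suc j)"
    by (simp_all add: field_simps)
  then have "\<lfloor>2 ^ Suc (Suc j) * (x / 2)\<rfloor> = \<lfloor>2 ^ Suc j * x\<rfloor>"
    "\<lfloor>2 ^ Suc (Suc j) * (1 / 2 + x / 2)\<rfloor> = \<lfloor>2 ^ Suc j * x\<rfloor> + 2 ^ Suc j"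
    by (simp_all only: floor_add_int)
  then show "rad (Suc j) (x / 2) = rad j x" "rad (Suc j) (1 / 2 + x / 2) = rad j x"
    unfolding rad_def by (simp_all only:) simp_all
qed

text \<open>Half-open intervals tile exactly, and the first digit is constant on each half. An
  indicator under \<open>lborel\<close> allows the affine substitution.\<close>

lemma integral_unit_interval_halves:
  fixes f :: "real \<Rightarrow> real"
  assumes [measurable]: "f \<in> borel_measurable borel" and bnd: "\<And>x. \<bar>f x\<bar> \<le> C"
  shows "(\<integral>x. indicator {0..<1} x * f x \<partial>lborel) =
    ((\<integral>x. indicator {0..<1} x * f (x / 2) \<partial>lborel) +
     (\<integral>x. indicator {0..<1} x * f (1 / 2 + x / 2) \<partial>lborel)) / 2"
proof -
  have int: "integrable lborel (\<lambda>x. indicator {a..<b} x * f x)" for a b :: real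
  proof (rule Bochner_Integration.integrable_bound)
    show "integrable lborel (\<lambda>x. C * indicator {a..<b} x)"
      by (cases "a \<le> b") auto
    show "AE x in lborel. norm (indicator {a..<b} x * f x) \<le> norm (C * indicator {a..<b} x)"
      using bnd by (auto simp: indicator_def abs_mult intro!: AE_I2 order_trans[OF bnd])
  qed measurable
  have "(\<integral>x. indicator {0..<1} x * f x \<partial>lborel) =
      (\<integral>x. indicator {0..<1/2} x * f x + indicator {1/2..<1} x * f x \<partial>lborel)"
    by (intro Bochner_Integration.integral_cong) (auto simp: indicator_def)
  also have "\<dots> = (\<integral>x. indicator {0..<1/2} x * f x \<partial>lborel) + (\<integral>x. indicator {1/2..<1} x * f x \<partial>lborel)"
    by (intro Bochner_Integration.integral_add int)
  also have "(\<integral>x. indicator {0..<1/2} x * f x \<partial>lborel) = (\<integral>x. indicator {0..<1} x * f (x / 2) \<partial>lborel) / 2"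
    by (subst lborel_integral_real_affine[where c = "1 / 2" and t = 0])
      (auto intro!: Bochner_Integration.integral_cong simp: indicator_def)
  also have "(\<integral>x. indicator {1/2..<1} x * f x \<partial>lborel) =
      (\<integral>x. indicator {0..<1} x * f (1 / 2 + x / 2) \<partial>lborel) / 2"
    by (subst lborel_integral_real_affine[where c = "1 / 2" and t = "1 / 2"])
      (auto intro!: Bochner_Integration.integral_cong simp: indicator_def)
  finally show ?thesis
    by (simp add: add_divide_distrib)
qed

text \<open>Independence of the digits, by self-similarity: on each half of the interval the factor
  with index 0 is a constant, and the remaining digits are those of the rescaled point.\<close>

lemma integral_prod_rad:
  fixes \<phi> :: "nat \<Rightarrow> real \<Rightarrow> real"
  shows "(\<integral>x. indicator {0..<1} x * (\<Prod>j<L. \<phi> j (rad j x)) \<partial>lborel) = (\<Prod>j<L. (\<phi> j 1 + \<phi> j (- 1)) / 2)"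
proof (induction L arbitrary: \<phi>)
  case (Suc L)
  define f where "f = (\<lambda>x. \<Prod>j<Suc L. \<phi> j (rad j x))"
  have "f \<in> borel_measurable borel"
    unfolding f_def by measurable
  moreover have "\<bar>f x\<bar> \<le> (\<Prod>j<Suc L. \<bar>\<phi> j 1\<bar> + \<bar>\<phi> j (- 1)\<bar>)" for x
    unfolding f_def abs_prod
  proof (intro prod_mono conjI)
    show "\<bar>\<phi> j (rad j x)\<bar> \<le> \<bar>\<phi> j 1\<bar> + \<bar>\<phi> j (- 1)\<bar>" for j
      using rad_cases[of j x] by auto
  qed auto
  ultimately have "(\<integral>x. indicator {0..<1} x * f x \<partial>lborel) =
    ((\<integral>x. indicator {0..<1} x * f (x / 2) \<partial>lborel) +
     (\<integral>x. indicator {0..<1} x * f (1 / 2 + x / 2) \<partial>lborel)) / 2"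
    by (rule integral_unit_interval_halves)
  also have "(\<lambda>x. indicator {0..<1} x * f (x / 2)) =
      (\<lambda>x. \<phi> 0 1 * (indicator {0..<1} x * (\<Prod>j<L. \<phi> (Suc j) (rad j x))))"
    by (auto simp: f_def prod.lessThan_Suc_shift rad_0 rad_Suc fun_eq_iff indicator_def simp del: prod.lessThan_Suc)
  also have "(\<lambda>x. indicator {0..<1} x * f (1 / 2 + x / 2)) =
      (\<lambda>x. \<phi> 0 (- 1) * (indicator {0..<1} x * (\<Prod>j<L. \<phi> (Suc j) (rad j x))))"
    by (auto simp: f_def prod.lessThan_Suc_shift rad_0 rad_Suc fun_eq_iff indicator_def simp del: prod.lessThan_Suc)
  finally show ?case
    unfolding f_def prod.lessThan_Suc_shift[of "\<lambda>j. (\<phi> j 1 + \<phi> j (- 1)) / 2"]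
    by (simp add: Suc.IH[of "\<lambda>j. \<phi> (Suc j)"] distrib_right del: prod.lessThan_Suc)
qed simp

lemma integral_unit_leb_borel:
  fixes f :: "real \<Rightarrow> real"
  assumes [measurable]: "f \<in> borel_measurable borel"
  shows "(\<integral>x. f x \<partial>unit_leb) = (\<integral>x. indicator {0..<1} x * f x \<partial>lborel)"
proof -
  have "(\<integral>x. f x \<partial>unit_leb) = (\<integral>x. indicator {0..1} x * f x \<partial>lebesgue)"
    by (subst integral_restrict_space) simp_all
  also have "\<dots> = (\<integral>x. indicator {0..1} x * f x \<partial>lborel)"
    by (rule integral_completion) measurable
  also have "\<dots> = (\<integral>x. indicator {0..<1} x * f x \<partial>lborel)"
  proof (rule integral_cong_AE)
    show "AE x in lborel. indicator {0..1} x * f x = indicator {0..<1} x * f x"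
      using AE_lborel_singleton[of "1 :: real"] by eventually_elim (auto simp: indicator_def)
  qed measurable
  finally show ?thesis .
qed

section \<open>Functions of finitely many binary digits as functions on the sign cube\<close>

definition rads :: "nat set \<Rightarrow> real \<Rightarrow> nat \<Rightarrow> real" where
  "rads S x = restrict (\<lambda>j. rad j x) S"

lemma rads_in_signs: "rads S x \<in> signs S"
  using rad_cases by (auto simp: rads_def signs_def)

lemma rads_apply: "j \<in> S \<Longrightarrow> rads S x j = rad j x"
  by (simp add: rads_def)

lemma restrict_rads: "T \<subseteq> S \<Longrightarrow> restrict (rads S x) T = rads T x"
  by (auto simp: rads_def restrict_def fun_eq_iff)

text \<open>It writes an arbitrary \<open>g\<close> on the finite cube as a finite combination of
  products of digit indicators, so measurability and integrals need to be known only for those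
  products.\<close>

lemma rads_expand:
  fixes g :: "(nat \<Rightarrow> real) \<Rightarrow> real"
  assumes "finite S"
  shows "g (rads S x) = (\<Sum>a\<in>signs S. g a * (\<Prod>j\<in>S. if rad j x = a j then 1 else 0))"
proof -
  have "(\<Prod>j\<in>S. if rad j x = a j then 1 else 0) = (if a = rads S x then 1 else 0 :: real)" if "a \<in> signs S" for a
  proof (cases "a = rads S x")
    case False
    have "\<exists>j\<in>S. rad j x \<noteq> a j"
    proof (rule ccontr)
      assume "\<not> ?thesis"
      then have "a = rads S x"
        using that by (intro ext) (auto simp: rads_def signs_def PiE_iff extensional_def)
      with False show False ..
    qed
    then show ?thesis
      using False assms by (auto simp: prod_zero_iff)
  qed (simp add: rads_apply)
  then have "(\<Sum>a\<in>signs S. g a * (\<Prod>j\<in>S. if rad j x = a j then 1 else 0)) =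
      (\<Sum>a\<in>signs S. if a = rads S x then g a else 0)"
    by (intro sum.cong) auto
  also have "\<dots> = g (rads S x)"
    using assms rads_in_signs by simp
  finally show ?thesis ..
qed

lemma prod_indicator_rad_measurable [measurable]:
  "(\<lambda>x. \<Prod>j\<in>S. if rad j x = a j then 1 else 0 :: real) \<in> borel_measurable borel"
  by (intro borel_measurable_prod rad_compose_measurable[of "\<lambda>t. if t = a j then 1 else 0" for a j])

lemma rads_measurable:
  fixes g :: "(nat \<Rightarrow> real) \<Rightarrow> real"
  assumes "finite S"
  shows "(\<lambda>x. g (rads S x)) \<in> borel_measurable borel"
  unfolding rads_expand[OF assms, of g] by measurable

lemma rads_measurable_unit_leb:
  fixes g :: "(nat \<Rightarrow> real) \<Rightarrow> real"
  assumes "finite S"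
  shows "(\<lambda>x. g (rads S x)) \<in> borel_measurable unit_leb"
proof -
  have "(\<lambda>x. g (rads S x)) \<in> borel_measurable lborel"
    using rads_measurable[OF assms] by simp
  then show ?thesis
    by (intro measurable_restrict_space1 measurable_completion)
qed

lemma integral_prod_indicator_rads:
  assumes "finite S" "a \<in> signs S"
  shows "(\<integral>x. (\<Prod>j\<in>S. if rad j x = a j then 1 else 0 :: real) \<partial>unit_leb) = (1 / 2 ^ card S :: real)"
proof -
  obtain L where L: "S \<subseteq> {..<L}"
    using assms(1) finite_nat_iff_bounded by auto
  \<comment> \<open>Factors 1 at the indices outside \<open>S\<close> fill the product up to an
    initial segment, the form required by \<open>integral_prod_rad\<close>.\<close>
  define \<phi> where "\<phi> j t = (if j \<in> S then if t = a j then 1 else 0 else 1 :: real)" for j t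
  have "(\<integral>x. (\<Prod>j\<in>S. if rad j x = a j then 1 else 0 :: real) \<partial>unit_leb) =
      (\<integral>x. indicator {0..<1} x * (\<Prod>j\<in>S. if rad j x = a j then 1 else 0 :: real) \<partial>lborel)"
    by (rule integral_unit_leb_borel) measurable
  also have "\<dots> = (\<integral>x. indicator {0..<1} x * (\<Prod>j<L. \<phi> j (rad j x)) \<partial>lborel)"
  proof -
    have "(\<Prod>j\<in>S. if rad j x = a j then 1 else 0 :: real) = (\<Prod>j<L. \<phi> j (rad j x))" for x
      using L by (intro prod.mono_neutral_cong_left) (auto simp: \<phi>_def)
    then show ?thesis
      by simp
  qed
  also have "\<dots> = (\<Prod>j<L. (\<phi> j 1 + \<phi> j (- 1)) / 2)"
    by (rule integral_prod_rad)
  also have "\<dots> = (\<Prod>j\<in>S. 1 / 2)"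
    using L assms by (intro prod.mono_neutral_cong_right) (auto simp: \<phi>_def signs_def PiE_iff)
  finally show ?thesis
    by (simp add: power_one_over)
qed

lemma integrable_rads:
  fixes g :: "(nat \<Rightarrow> real) \<Rightarrow> real"
  assumes "finite S"
  shows "integrable unit_leb (\<lambda>x. g (rads S x))"
proof (rule finite_measure.integrable_const_bound)
  show "finite_measure unit_leb"
    by (rule finite_measureI) (simp add: emeasure_restrict_space space_restrict_space)
  show "AE x in unit_leb. norm (g (rads S x)) \<le> (\<Sum>a\<in>signs S. \<bar>g a\<bar>)"
    using assms rads_in_signs by (intro AE_I2) (auto intro!: member_le_sum)
qed (rule rads_measurable_unit_leb[OF assms])

lemma integral_rads:
  fixes g :: "(nat \<Rightarrow> real) \<Rightarrow> real"
  assumes "finite S"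
  shows "(\<integral>x. g (rads S x) \<partial>unit_leb) = savg S g"
proof -
  define \<psi> where "\<psi> a b = (\<Prod>j\<in>S. if b j = a j then 1 else 0 :: real)" for a b :: "nat \<Rightarrow> real"
  have \<psi>: "\<psi> a (rads S x) = (\<Prod>j\<in>S. if rad j x = a j then 1 else 0)" for a x
    unfolding \<psi>_def by (intro prod.cong) (simp_all add: rads_apply)
  have "(\<integral>x. g (rads S x) \<partial>unit_leb) = (\<integral>x. (\<Sum>a\<in>signs S. g a * \<psi> a (rads S x)) \<partial>unit_leb)"
    unfolding rads_expand[OF assms, of g] \<psi> ..
  also have "\<dots> = (\<Sum>a\<in>signs S. \<integral>x. g a * \<psi> a (rads S x) \<partial>unit_leb)"
    by (intro Bochner_Integration.integral_sum integrable_rads[OF assms])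
  also have "\<dots> = (\<Sum>a\<in>signs S. g a * (1 / 2 ^ card S))"
    by (intro sum.cong) (simp_all add: \<psi> integral_prod_indicator_rads[OF assms])
  finally show ?thesis
    by (simp add: savg_def sum_divide_distrib)
qed

section \<open>Embeddings of the sequence space into Lp\<close>

lemma ae_eq_refl_iff: "ae_eq f f \<longleftrightarrow> f \<in> borel_measurable unit_leb"
  by (simp add: ae_eq_def)

lemma L0_exhaust:
  obtains f where "f \<in> borel_measurable unit_leb" "F = abs_L0 f"
proof (rule that)
  show "rep_L0 F \<in> borel_measurable unit_leb"
    using Quotient3_rep_reflp[OF Quotient3_L0] by (simp flip: ae_eq_refl_iff)
  show "F = abs_L0 (rep_L0 F)"
    by (simp add: Quotient3_abs_rep[OF Quotient3_L0])
qed

lemma abs_L0_in_Lp_iff: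
  "f \<in> borel_measurable unit_leb \<Longrightarrow> abs_L0 f \<in> Lp p \<longleftrightarrow> integrable unit_leb (\<lambda>x. \<bar>f x\<bar> powr p)"
  by (simp add: Lp_def in_Lp.abs_eq ae_eq_refl_iff)

lemma Lp_norm_abs_L0:
  "f \<in> borel_measurable unit_leb \<Longrightarrow>
    Lp_norm p (abs_L0 f) = (\<integral>x. \<bar>f x\<bar> powr p \<partial>unit_leb) powr (1 / p)"
  by (simp add: Lp_norm.abs_eq ae_eq_refl_iff)

lemma abs_L0_diff:
  "f \<in> borel_measurable unit_leb \<Longrightarrow> g \<in> borel_measurable unit_leb \<Longrightarrow>
    abs_L0 f - abs_L0 g = abs_L0 (\<lambda>x. f x - g x)"
  by (simp add: minus_L0.abs_eq ae_eq_refl_iff)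

lemma abs_L0_lincomb:
  assumes "finite K" "\<And>k. k \<in> K \<Longrightarrow> f k \<in> borel_measurable unit_leb"
  shows "abs_L0 (\<lambda>x. \<Sum>k\<in>K. c k * f k x) = (\<Sum>k\<in>K. c k *\<^sub>R abs_L0 (f k))"
  using assms
proof (induction K rule: finite_induct)
  case empty
  then show ?case by (simp add: zero_L0_def)
next
  case (insert k K)
  have "ae_eq (\<lambda>x. c k * f k x) (\<lambda>x. c k * f k x)" "ae_eq (f k) (f k)"
    "ae_eq (\<lambda>x. \<Sum>k\<in>K. c k * f k x) (\<lambda>x. \<Sum>k\<in>K. c k * f k x)"
    unfolding ae_eq_refl_iff using insert.prems by (auto intro!: borel_measurable_sum borel_measurable_times)
  then show ?case
    using insert by (simp add: plus_L0.abs_eq[symmetric] scaleR_L0.abs_eq[symmetric])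
qed

section \<open>Completeness of the spaces \<open>Lp p\<close>\<close>

lemma finite_measure_unit_leb: "finite_measure unit_leb"
  by (rule finite_measureI) (simp add: emeasure_restrict_space space_restrict_space)

lemma measure_unit_leb: "measure unit_leb {0..1} = 1"
  by (simp add: measure_restrict_space)

text \<open>Above the threshold \<open>\<delta>\<close> the factor
  \<open>\<bar>t\<bar> powr (1 - p)\<close> is at most \<open>\<delta> powr (1 - p)\<close>. Here
  this takes the place of Hoelder's inequality wherever an L1 quantity has to be controlled by an
  \<open>Lp\<close> quantity.\<close>

lemma abs_le_add_powr:
  fixes t \<delta> p :: real
  assumes "1 \<le> p" "0 < \<delta>"
  shows "\<bar>t\<bar> \<le> \<delta> + \<delta> powr (1 - p) * \<bar>t\<bar> powr p"
proof (cases "\<bar>t\<bar> \<le> \<delta>")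
  case True
  then show ?thesis
    by (simp add: add_increasing2)
next
  case False
  then have "\<bar>t\<bar> = \<bar>t\<bar> powr (1 - p) * \<bar>t\<bar> powr p"
    using assms by (simp add: powr_add[symmetric])
  also have "\<dots> \<le> \<delta> powr (1 - p) * \<bar>t\<bar> powr p"
    using False assms by (intro mult_right_mono powr_mono2') auto
  finally show ?thesis
    using assms by linarith
qed

text \<open>A Cauchy sequence in \<open>Lp\<close> is Cauchy in L1 by
  \<open>abs_le_add_powr\<close>, since the measure is finite. That yields a subsequence converging
  almost everywhere, and Fatou's lemma shows its limit to be the limit in \<open>Lp\<close>.\<close>

lemma Lp_complete:
  assumes p: "1 \<le> p" and F: "\<And>n. F n \<in> Lp p"
    and Cauchy: "\<And>e. 0 < e \<Longrightarrow> \<exists>N. \<forall>i\<ge>N. \<forall>j\<ge>N. Lp_norm p (F i - F j) < e"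
  obtains G where "G \<in> Lp p" "(\<lambda>n. Lp_norm p (F n - G)) \<longlonglongrightarrow> 0"
proof -
  interpret finite_measure unit_leb
    by (rule finite_measure_unit_leb)
  have "\<exists>f. f \<in> borel_measurable unit_leb \<and> F n = abs_L0 f" for n
    by (metis L0_exhaust)
  then obtain f where f [measurable]: "\<And>n. f n \<in> borel_measurable unit_leb" and Ff: "\<And>n. F n = abs_L0 (f n)"
    by metis
  have fi: "integrable unit_leb (\<lambda>x. \<bar>f n x\<bar> powr p)" for n
    using F[of n] by (simp add: Ff abs_L0_in_Lp_iff)
  have di: "integrable unit_leb (\<lambda>x. \<bar>f i x - f j x\<bar> powr p)" for i j
    using subspace_diff[OF subspace_Lp[OF p] F F, of i j] by (simp add: Ff abs_L0_diff abs_L0_in_Lp_iff)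
  define I where "I i j = (\<integral>x. \<bar>f i x - f j x\<bar> powr p \<partial>unit_leb)" for i j
  have I: "\<exists>N. \<forall>i\<ge>N. \<forall>j\<ge>N. I i j < e" if e: "0 < e" for e
  proof -
    obtain N where N: "\<forall>i\<ge>N. \<forall>j\<ge>N. Lp_norm p (F i - F j) < e powr (1 / p)"
      using Cauchy[of "e powr (1 / p)"] e by auto
    have "I i j < e" if "i \<ge> N" "j \<ge> N" for i j
    proof (rule ccontr)
      assume "\<not> ?thesis"
      then have "e powr (1 / p) \<le> I i j powr (1 / p)"
        using e p by (intro powr_mono2) auto
      moreover have "I i j powr (1 / p) < e powr (1 / p)"
        using N that by (simp add: Ff abs_L0_diff Lp_norm_abs_L0 I_def)
      ultimately show False
        by linarith
    qed
    then show ?thesis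
      by blast
  qed
  have f1: "integrable unit_leb (f n)" for n
  proof (rule Bochner_Integration.integrable_bound)
    show "integrable unit_leb (\<lambda>x. 1 + \<bar>f n x\<bar> powr p)"
      using fi by auto
    show "AE x in unit_leb. norm (f n x) \<le> norm (1 + \<bar>f n x\<bar> powr p)"
      using abs_le_add_powr[OF p, of 1] by (intro AE_I2) simp
  qed measurable
  have L1: "\<exists>N. \<forall>i\<ge>N. \<forall>j\<ge>N. (\<integral>x. norm (f i x - f j x) \<partial>unit_leb) < e" if e: "0 < e" for e
  proof -
    \<comment> \<open>The threshold is \<open>e / 2\<close>: it uses up half of \<open>e\<close>,
      and the other half is left for \<open>c * I i j\<close>.\<close>
    define c where "c = (e / 2) powr (1 - p)"
    have c: "0 < c"
      using e by (simp add: c_def)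
    obtain N where N: "\<forall>i\<ge>N. \<forall>j\<ge>N. I i j < e / 2 / c"
      using I[of "e / 2 / c"] e c by auto
    have "(\<integral>x. norm (f i x - f j x) \<partial>unit_leb) < e" if "i \<ge> N" "j \<ge> N" for i j
    proof -
      have "(\<integral>x. norm (f i x - f j x) \<partial>unit_leb) \<le> (\<integral>x. e / 2 + c * \<bar>f i x - f j x\<bar> powr p \<partial>unit_leb)"
        unfolding c_def real_norm_def
        using f1 di e by (intro integral_mono abs_le_add_powr p) auto
      also have "\<dots> = e / 2 + c * I i j"
        using di by (simp add: I_def measure_unit_leb)
      also have "\<dots> < e / 2 + c * (e / 2 / c)"
        using N that c by (intro add_strict_left_mono mult_strict_left_mono) auto
      finally show ?thesis
        using c by simp
    qed
    then show ?thesis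
      by blast
  qed
  obtain r where r: "strict_mono r" "AE x in unit_leb. Cauchy (\<lambda>i. f (r i) x)"
    by (rule cauchy_L1_AE_cauchy_subseq[OF f1 L1]) auto
  define g where "g x = lim (\<lambda>i. f (r i) x)" for x
  have g [measurable]: "g \<in> borel_measurable unit_leb"
    unfolding g_def by measurable
  have lim: "AE x in unit_leb. (\<lambda>i. f (r i) x) \<longlonglongrightarrow> g x"
    using r(2) by eventually_elim (simp add: g_def convergent_LIMSEQ_iff[symmetric] Cauchy_convergent)
  \<comment> \<open>Fatou's lemma along the subsequence \<open>r\<close>: a bound on
    \<open>I n j\<close> for all large \<open>j\<close> passes to \<open>g\<close> and gives
    integrability together with the estimate.\<close>
  have bound: "integrable unit_leb (\<lambda>x. \<bar>f n x - g x\<bar> powr p) \<and> (\<integral>x. \<bar>f n x - g x\<bar> powr p \<partial>unit_leb) \<le> e"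
    if e: "0 \<le> e" and N: "\<And>j. j \<ge> N \<Longrightarrow> I n j \<le> e" for n N e
  proof -
    have "(\<integral>\<^sup>+x. ennreal (\<bar>f n x - g x\<bar> powr p) \<partial>unit_leb) =
        (\<integral>\<^sup>+x. liminf (\<lambda>i. ennreal (\<bar>f n x - f (r i) x\<bar> powr p)) \<partial>unit_leb)"
    proof (rule nn_integral_cong_AE)
      show "AE x in unit_leb. ennreal (\<bar>f n x - g x\<bar> powr p) = liminf (\<lambda>i. ennreal (\<bar>f n x - f (r i) x\<bar> powr p))"
        using lim
      proof eventually_elim
        case (elim x)
        have "(\<lambda>i. \<bar>f n x - f (r i) x\<bar> powr p) \<longlonglongrightarrow> \<bar>f n x - g x\<bar> powr p"
          using p by (intro tendsto_powr2 tendsto_intros elim) auto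
        then have "(\<lambda>i. ennreal (\<bar>f n x - f (r i) x\<bar> powr p)) \<longlonglongrightarrow> ennreal (\<bar>f n x - g x\<bar> powr p)"
          by (intro tendsto_ennrealI)
        then show ?case
          by (intro lim_imp_Liminf [symmetric]) simp
      qed
    qed
    also have "\<dots> \<le> liminf (\<lambda>i. \<integral>\<^sup>+x. ennreal (\<bar>f n x - f (r i) x\<bar> powr p) \<partial>unit_leb)"
      by (rule nn_integral_liminf) measurable
    also have "\<dots> = liminf (\<lambda>i. ennreal (I n (r i)))"
      using di by (simp add: nn_integral_eq_integral I_def)
    also have "\<dots> \<le> ennreal e"
    proof (rule Liminf_le)
      have "eventually (\<lambda>i. r i \<ge> N) sequentially"
        using filterlim_subseq[OF r(1)] by (auto simp: filterlim_at_top)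
      then show "\<forall>\<^sub>F i in sequentially. ennreal (I n (r i)) \<le> ennreal e"
        by eventually_elim (auto intro!: ennreal_leI N)
    qed simp
    finally have le: "(\<integral>\<^sup>+x. ennreal (\<bar>f n x - g x\<bar> powr p) \<partial>unit_leb) \<le> ennreal e" .
    have "integrable unit_leb (\<lambda>x. \<bar>f n x - g x\<bar> powr p)"
      using le by (intro integrableI_bounded) (auto simp: top_unique less_top[symmetric])
    moreover from this have "(\<integral>x. \<bar>f n x - g x\<bar> powr p \<partial>unit_leb) \<le> e"
      using le e by (simp add: nn_integral_eq_integral)
    ultimately show ?thesis ..
  qed
  have diff_in: "F n - abs_L0 g \<in> Lp p" if "\<And>j. j \<ge> N \<Longrightarrow> I n j \<le> e" "0 \<le> e" for n N e
    using bound[OF that(2,1)] by (simp add: Ff abs_L0_diff abs_L0_in_Lp_iff)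
  obtain N1 where "\<forall>i\<ge>N1. \<forall>j\<ge>N1. I i j < 1"
    using I[of 1] by auto
  then have "F N1 - abs_L0 g \<in> Lp p"
    by (intro diff_in[of N1 N1 1]) (auto intro: less_imp_le)
  from subspace_diff[OF subspace_Lp[OF p] F[of N1] this] have "abs_L0 g \<in> Lp p"
    by simp
  moreover have "(\<lambda>n. Lp_norm p (F n - abs_L0 g)) \<longlonglongrightarrow> 0"
  proof (rule LIMSEQ_I)
    fix e :: real assume e: "0 < e"
    obtain N where N: "\<forall>i\<ge>N. \<forall>j\<ge>N. I i j < (e / 2) powr p"
      using I[of "(e / 2) powr p"] e by auto
    have "Lp_norm p (F n - abs_L0 g) \<le> e / 2" if "n \<ge> N" for n
    proof -
      have "(\<integral>x. \<bar>f n x - g x\<bar> powr p \<partial>unit_leb) \<le> (e / 2) powr p"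
        using N that by (intro bound[of _ N n, THEN conjunct2]) (auto intro: less_imp_le)
      then have "(\<integral>x. \<bar>f n x - g x\<bar> powr p \<partial>unit_leb) powr (1 / p) \<le> ((e / 2) powr p) powr (1 / p)"
        using p by (intro powr_mono2) auto
      also have "\<dots> = e / 2"
        using e p by (simp add: powr_powr)
      finally show ?thesis
        by (simp add: Ff abs_L0_diff Lp_norm_abs_L0)
    qed
    then show "\<exists>N. \<forall>n\<ge>N. norm (Lp_norm p (F n - abs_L0 g) - 0) < e"
      using e by (intro exI[of _ N]) (force simp: Lp_norm_nonneg)
  qed
  ultimately show thesis
    by (rule that)
qed

section \<open>The sequence space: norm, completeness and unit vectors\<close>

lemma norm_ell2_square: "(norm x)\<^sup>2 = (\<Sum>n. (Rep_ell2 x n)\<^sup>2)"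
  by (simp add: norm_ell2_def inner_ell2.rep_eq power2_eq_square[symmetric])
     (simp add: power2_eq_square suminf_nonneg Rep_ell2[simplified, unfolded power2_eq_square])

lemma summable_Rep_ell2: "summable (\<lambda>n. (Rep_ell2 x n)\<^sup>2)"
  using Rep_ell2 by auto

lemma sum_Rep_ell2_le:
  assumes "finite K"
  shows "(\<Sum>k\<in>K. (Rep_ell2 x k)\<^sup>2) \<le> (norm x)\<^sup>2"
  unfolding norm_ell2_square using assms summable_Rep_ell2 by (intro sum_le_suminf) auto

lemma sum_Rep_ell2_tendsto: "(\<lambda>M. sqrt (\<Sum>k<M. (Rep_ell2 x k)\<^sup>2)) \<longlonglongrightarrow> norm x"
proof -
  have "(\<lambda>M. sqrt (\<Sum>k<M. (Rep_ell2 x k)\<^sup>2)) \<longlonglongrightarrow> sqrt ((norm x)\<^sup>2)"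
    unfolding norm_ell2_square by (intro tendsto_real_sqrt summable_LIMSEQ summable_Rep_ell2)
  then show ?thesis
    by simp
qed

text \<open>The coordinates converge. The Cauchy estimate, restricted to finitely many coordinates,
  passes to their limits \<open>l k\<close> with a bound independent of the number of coordinates,
  which gives both summability and convergence in norm.\<close>

lemma ell2_complete:
  fixes X :: "nat \<Rightarrow> ell2"
  assumes "Cauchy X"
  obtains L where "X \<longlonglongrightarrow> L"
proof -
  have "Cauchy (\<lambda>n. Rep_ell2 (X n) k)" for k
  proof (rule metric_CauchyI)
    fix e :: real assume "0 < e"
    then obtain N where N: "\<forall>m\<ge>N. \<forall>n\<ge>N. dist (X m) (X n) < e"
      using metric_CauchyD[OF assms] by blast
    have "dist (Rep_ell2 (X m) k) (Rep_ell2 (X n) k) \<le> dist (X m) (X n)" for m n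
    proof -
      have "(Rep_ell2 (X m - X n) k)\<^sup>2 \<le> (norm (X m - X n))\<^sup>2"
        using sum_Rep_ell2_le[of "{k}"] by simp
      then have "\<bar>Rep_ell2 (X m - X n) k\<bar> \<le> norm (X m - X n)"
        by (simp add: abs_le_square_iff[symmetric])
      then show ?thesis
        by (simp add: dist_norm minus_ell2.rep_eq)
    qed
    with N show "\<exists>N. \<forall>m\<ge>N. \<forall>n\<ge>N. dist (Rep_ell2 (X m) k) (Rep_ell2 (X n) k) < e"
      by (meson le_less_trans)
  qed
  then obtain l where l: "\<And>k. (\<lambda>n. Rep_ell2 (X n) k) \<longlonglongrightarrow> l k"
    unfolding Cauchy_convergent_iff convergent_def by metis
  have part: "(\<Sum>k<K. (Rep_ell2 (X m) k - l k)\<^sup>2) \<le> e\<^sup>2"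
    if "0 < e" and N: "\<forall>n\<ge>N. dist (X m) (X n) < e" for e K m N
  proof (rule LIMSEQ_le_const2)
    show "(\<lambda>n. \<Sum>k<K. (Rep_ell2 (X m) k - Rep_ell2 (X n) k)\<^sup>2) \<longlonglongrightarrow> (\<Sum>k<K. (Rep_ell2 (X m) k - l k)\<^sup>2)"
      by (intro tendsto_intros l)
    have "(\<Sum>k<K. (Rep_ell2 (X m) k - Rep_ell2 (X n) k)\<^sup>2) \<le> e\<^sup>2" if "n \<ge> N" for n
    proof -
      have "(\<Sum>k<K. (Rep_ell2 (X m) k - Rep_ell2 (X n) k)\<^sup>2) \<le> (dist (X m) (X n))\<^sup>2"
        using sum_Rep_ell2_le[of "{..<K}" "X m - X n"] by (simp add: dist_norm minus_ell2.rep_eq)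
      also have "\<dots> \<le> e\<^sup>2"
        using N that by (intro power_mono) (auto intro: less_imp_le)
      finally show ?thesis .
    qed
    then show "\<exists>N. \<forall>n\<ge>N. (\<Sum>k<K. (Rep_ell2 (X m) k - Rep_ell2 (X n) k)\<^sup>2) \<le> e\<^sup>2"
      by blast
  qed
  have summ: "summable (\<lambda>k. (Rep_ell2 (X m) k - l k)\<^sup>2)"
    if "0 < e" and N: "\<forall>n\<ge>N. dist (X m) (X n) < e" for e m N
    using part[OF that] by (intro bounded_imp_summable[where B = "e\<^sup>2"]) (auto simp: lessThan_Suc_atMost[symmetric] simp del: sum.lessThan_Suc)
  obtain N1 where N1: "\<forall>m\<ge>N1. \<forall>n\<ge>N1. dist (X m) (X n) < 1"
    using metric_CauchyD[OF assms, of 1] by auto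
  then have "summable (\<lambda>k. (Rep_ell2 (X N1) k - l k)\<^sup>2)"
    by (intro summ[of 1 N1]) auto
  from ell2_summable_lincomb[OF summable_Rep_ell2[of "X N1"] this, of "- 1"]
  have "summable (\<lambda>k. (l k)\<^sup>2)"
    by simp
  then have L: "Rep_ell2 (Abs_ell2 l) = l"
    by (intro Abs_ell2_inverse) simp
  have "X \<longlonglongrightarrow> Abs_ell2 l"
  proof (rule metric_LIMSEQ_I)
    fix e :: real assume e: "0 < e"
    then obtain N where N: "\<forall>m\<ge>N. \<forall>n\<ge>N. dist (X m) (X n) < e / 2"
      using metric_CauchyD[OF assms, of "e / 2"] by auto
    have "dist (X m) (Abs_ell2 l) < e" if "m \<ge> N" for m
    proof -
      have 0: "0 < e / 2" "\<forall>n\<ge>N. dist (X m) (X n) < e / 2"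
        using e N that by auto
      have "(norm (X m - Abs_ell2 l))\<^sup>2 \<le> (e / 2)\<^sup>2"
        unfolding norm_ell2_square minus_ell2.rep_eq L
        by (rule suminf_le_const[OF summ[OF 0] part[OF 0]])
      then have "norm (X m - Abs_ell2 l) \<le> e / 2"
        using e by - (rule power2_le_imp_le, auto)
      then show ?thesis
        using e by (simp add: dist_norm)
    qed
    then show "\<exists>N. \<forall>n\<ge>N. dist (X n) (Abs_ell2 l) < e"
      by blast
  qed
  then show thesis
    by (rule that)
qed

definition ell2_unit :: "nat \<Rightarrow> ell2" where
  "ell2_unit j = Abs_ell2 (\<lambda>k. if k = j then 1 else 0)"

lemma Rep_ell2_unit: "Rep_ell2 (ell2_unit j) = (\<lambda>k. if k = j then 1 else 0)"
proof -
  have "summable (\<lambda>k. (if k = j then 1 else 0 :: real)\<^sup>2)"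
    by (rule summable_finite[of "{j}"]) auto
  then show ?thesis
    unfolding ell2_unit_def by (intro Abs_ell2_inverse) simp
qed

section \<open>From two-sided estimates on finite combinations to a closed copy of the sequence
  space\<close>

lemma Lp_norm_minus_commute: "1 \<le> p \<Longrightarrow> Lp_norm p (f - g) = Lp_norm p (g - f)"
  using Lp_norm_scaleR[of p "- 1" "f - g"] by simp

lemma Lp_norm_le_diff:
  assumes "1 \<le> p" "f \<in> Lp p" "g \<in> Lp p"
  shows "\<bar>Lp_norm p f - Lp_norm p g\<bar> \<le> Lp_norm p (f - g)"
proof -
  have "f - g \<in> Lp p" "g - f \<in> Lp p"
    using assms by (auto intro: subspace_diff[OF subspace_Lp])
  then have "Lp_norm p ((f - g) + g) \<le> Lp_norm p (f - g) + Lp_norm p g"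
    "Lp_norm p ((g - f) + f) \<le> Lp_norm p (g - f) + Lp_norm p f"
    using assms by - (rule Lp_norm_triangle, assumption+)+
  then show ?thesis
    using Lp_norm_minus_commute[OF assms(1), of f g] by simp
qed

lemma Lp_limit_unique:
  assumes p: "1 \<le> p" and "\<And>n. F n \<in> Lp p" "G \<in> Lp p" "H \<in> Lp p"
    "(\<lambda>n. Lp_norm p (F n - G)) \<longlonglongrightarrow> 0" "(\<lambda>n. Lp_norm p (F n - H)) \<longlonglongrightarrow> 0"
  shows "G = H"
proof -
  note sub = subspace_diff[OF subspace_Lp[OF p]]
  have "Lp_norm p (G - H) \<le> Lp_norm p (F n - G) + Lp_norm p (F n - H)" for n
    using Lp_norm_triangle[OF p, of "G - F n" "F n - H"] assms(2-4) sub
    by (simp add: Lp_norm_minus_commute[OF p, of G "F n"])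
  then have "Lp_norm p (G - H) \<le> 0 + 0"
    by (intro LIMSEQ_le_const[OF tendsto_add[OF assms(5,6)]]) auto
  then have "Lp_norm p (G - H) = 0"
    using Lp_norm_nonneg[of p "G - H"] by simp
  then show ?thesis
    using Lp_norm_eq_0_iff[OF p, of "G - H"] assms sub by simp
qed

text \<open>\<open>T y\<close> is the \<open>Lp\<close> limit of the partial sums with coefficients
  from \<open>y\<close>: the upper estimate makes them Cauchy, and both estimates survive the
  limit.\<close>

lemma ell2_embedding_of_basis:
  fixes e :: "nat \<Rightarrow> L0"
  assumes p: "1 \<le> p" and e: "\<And>j. e j \<in> Lp p" and C: "0 < C"
    and lower: "\<And>M y. c * sqrt (\<Sum>j<M. (y j)\<^sup>2) \<le> Lp_norm p (\<Sum>j<M. y j *\<^sub>R e j)"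
    and upper: "\<And>M y. Lp_norm p (\<Sum>j<M. y j *\<^sub>R e j) \<le> C * sqrt (\<Sum>j<M. (y j)\<^sup>2)"
  obtains T :: "ell2 \<Rightarrow> L0" where "linear T" "\<forall>y. T y \<in> Lp p"
    "\<forall>y. c * norm y \<le> Lp_norm p (T y)" "\<forall>y. Lp_norm p (T y) \<le> C * norm y"
    "\<forall>j. T (ell2_unit j) = e j"
proof -
  note subL = subspace_Lp[OF p]
  define s where "s y M = (\<Sum>j<M. Rep_ell2 y j *\<^sub>R e j)" for y M
  have sLp: "s y M \<in> Lp p" for y M
    unfolding s_def by (intro subspace_sum[OF subL] subspace_scale[OF subL] e)
  have "\<exists>G. G \<in> Lp p \<and> (\<lambda>M. Lp_norm p (s y M - G)) \<longlonglongrightarrow> 0" for y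
  proof -
    have diff: "Lp_norm p (s y i - s y j) \<le> C * sqrt (\<bar>(\<Sum>k<i. (Rep_ell2 y k)\<^sup>2) - (\<Sum>k<j. (Rep_ell2 y k)\<^sup>2)\<bar>)"
      if "j \<le> i" for i j
    proof -
      \<comment> \<open>The upper estimate speaks of initial segments only, so the tail from
        \<open>j\<close> on is padded with zeros in front.\<close>
      define z where "z k = (if k < j then 0 else Rep_ell2 y k)" for k
      have split: "(\<Sum>k<i. g k) = (\<Sum>k<j. g k) + (\<Sum>k=j..<i. g k)" for g :: "nat \<Rightarrow> 'b::comm_monoid_add"
        using sum.atLeastLessThan_concat[of 0 j i g] that by (simp add: atLeast0LessThan)
      have "s y i - s y j = (\<Sum>k=j..<i. Rep_ell2 y k *\<^sub>R e k)"
        unfolding s_def by (subst split) simp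
      also have "\<dots> = (\<Sum>k<i. z k *\<^sub>R e k)"
        unfolding split[of "\<lambda>k. z k *\<^sub>R e k"] by (simp add: z_def)
      finally have "Lp_norm p (s y i - s y j) \<le> C * sqrt (\<Sum>k<i. (z k)\<^sup>2)"
        using upper by simp
      also have "(\<Sum>k<i. (z k)\<^sup>2) = (\<Sum>k=j..<i. (Rep_ell2 y k)\<^sup>2)"
        unfolding split[of "\<lambda>k. (z k)\<^sup>2"] by (simp add: z_def)
      also have "\<dots> = \<bar>(\<Sum>k<i. (Rep_ell2 y k)\<^sup>2) - (\<Sum>k<j. (Rep_ell2 y k)\<^sup>2)\<bar>"
        unfolding split[of "\<lambda>k. (Rep_ell2 y k)\<^sup>2"] by (simp add: sum_nonneg)
      finally show ?thesis .
    qed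
    have diff': "Lp_norm p (s y i - s y j) \<le> C * sqrt (\<bar>(\<Sum>k<i. (Rep_ell2 y k)\<^sup>2) - (\<Sum>k<j. (Rep_ell2 y k)\<^sup>2)\<bar>)"
      for i j
      using diff[of i j] diff[of j i] by (cases "j \<le> i") (auto simp: Lp_norm_minus_commute[OF p, of "s y i" "s y j"] abs_minus_commute)
    have "Cauchy (\<lambda>M. \<Sum>k<M. (Rep_ell2 y k)\<^sup>2)"
      by (rule LIMSEQ_imp_Cauchy[OF summable_LIMSEQ[OF summable_Rep_ell2]])
    have "\<exists>N. \<forall>i\<ge>N. \<forall>j\<ge>N. Lp_norm p (s y i - s y j) < d" if d: "0 < d" for d
    proof -
      obtain N where N: "\<forall>i\<ge>N. \<forall>j\<ge>N. dist (\<Sum>k<i. (Rep_ell2 y k)\<^sup>2) (\<Sum>k<j. (Rep_ell2 y k)\<^sup>2) < (d / C)\<^sup>2"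
        using metric_CauchyD[OF \<open>Cauchy _\<close>, of "(d / C)\<^sup>2"] d C by auto
      have "Lp_norm p (s y i - s y j) < d" if "i \<ge> N" "j \<ge> N" for i j
      proof -
        have "sqrt (\<bar>(\<Sum>k<i. (Rep_ell2 y k)\<^sup>2) - (\<Sum>k<j. (Rep_ell2 y k)\<^sup>2)\<bar>) < d / C"
          using N that d C by (intro real_less_lsqrt) (auto simp: dist_real_def)
        then have "C * sqrt (\<bar>(\<Sum>k<i. (Rep_ell2 y k)\<^sup>2) - (\<Sum>k<j. (Rep_ell2 y k)\<^sup>2)\<bar>) < d"
          using C by (simp add: field_simps)
        with diff'[of i j] show ?thesis
          by linarith
      qed
      then show ?thesis by blast
    qed
    then obtain G where "G \<in> Lp p" "(\<lambda>M. Lp_norm p (s y M - G)) \<longlonglongrightarrow> 0"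
      by (rule Lp_complete[OF p sLp])
    then show ?thesis
      by blast
  qed
  then obtain T where T: "\<And>y. T y \<in> Lp p" and lim: "\<And>y. (\<lambda>M. Lp_norm p (s y M - T y)) \<longlonglongrightarrow> 0"
    by metis
  \<comment> \<open>Linearity and the values on the unit vectors are read off from limits of partial
    sums by this uniqueness.\<close>
  have unique: "T y = G" if "G \<in> Lp p" "(\<lambda>M. Lp_norm p (s y M - G)) \<longlonglongrightarrow> 0" for y G
    by (rule Lp_limit_unique[OF p sLp T that(1) lim that(2)])
  have norm_lim: "(\<lambda>M. Lp_norm p (s y M)) \<longlonglongrightarrow> Lp_norm p (T y)" for y
  proof (rule LIM_zero_cancel, rule Lim_null_comparison[OF _ lim])
    show "\<forall>\<^sub>F M in sequentially. norm (Lp_norm p (s y M) - Lp_norm p (T y)) \<le> Lp_norm p (s y M - T y)"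
      using Lp_norm_le_diff[OF p sLp T] by simp
  qed
  show thesis
  proof (rule that[of T])
    show "linear T"
    proof (rule linearI)
      fix y z
      show "T (y + z) = T y + T z"
      proof (rule unique)
        show "T y + T z \<in> Lp p"
          by (intro subspace_add[OF subL] T)
        have e: "s (y + z) M - (T y + T z) = (s y M - T y) + (s z M - T z)" for M
          by (simp add: s_def plus_ell2.rep_eq scaleR_left_distrib sum.distrib)
        have "Lp_norm p (s (y + z) M - (T y + T z)) \<le> Lp_norm p (s y M - T y) + Lp_norm p (s z M - T z)" for M
          unfolding e by (intro Lp_norm_triangle[OF p] subspace_diff[OF subL] sLp T)
        moreover have "(\<lambda>M. Lp_norm p (s y M - T y) + Lp_norm p (s z M - T z)) \<longlonglongrightarrow> 0"
          using tendsto_add[OF lim lim] by simp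
        ultimately show "(\<lambda>M. Lp_norm p (s (y + z) M - (T y + T z))) \<longlonglongrightarrow> 0"
          by - (rule Lim_null_comparison[rotated], auto simp: Lp_norm_nonneg)
      qed
    next
      fix a y
      show "T (a *\<^sub>R y) = a *\<^sub>R T y"
      proof (rule unique)
        show "a *\<^sub>R T y \<in> Lp p"
          by (intro subspace_scale[OF subL] T)
        have "s (a *\<^sub>R y) M - a *\<^sub>R T y = a *\<^sub>R (s y M - T y)" for M
          by (simp add: s_def scaleR_ell2.rep_eq scaleR_sum_right scaleR_diff_right)
        then show "(\<lambda>M. Lp_norm p (s (a *\<^sub>R y) M - a *\<^sub>R T y)) \<longlonglongrightarrow> 0"
          using tendsto_mult_left[OF lim, of "\<bar>a\<bar>" y] by (simp add: Lp_norm_scaleR[OF p])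
      qed
    qed
    show "\<forall>y. T y \<in> Lp p"
      using T by blast
    have "c * norm y \<le> Lp_norm p (T y)" for y
      using lower by (intro LIMSEQ_le[OF tendsto_mult_left[OF sum_Rep_ell2_tendsto] norm_lim]) (auto simp: s_def)
    then show "\<forall>y. c * norm y \<le> Lp_norm p (T y)"
      by blast
    have "Lp_norm p (T y) \<le> C * norm y" for y
      using upper by (intro LIMSEQ_le[OF norm_lim tendsto_mult_left[OF sum_Rep_ell2_tendsto]]) (auto simp: s_def)
    then show "\<forall>y. Lp_norm p (T y) \<le> C * norm y"
      by blast
    have "T (ell2_unit j) = e j" for j
    proof (rule unique)
      have "s (ell2_unit j) M = e j" if "M > j" for M
      proof -
        have "s (ell2_unit j) M = (\<Sum>k<M. if k = j then e k else 0)"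
          unfolding s_def Rep_ell2_unit by (intro sum.cong) auto
        with that show ?thesis
          by simp
      qed
      then have "\<forall>\<^sub>F M in sequentially. Lp_norm p (s (ell2_unit j) M - e j) = 0"
        using Lp_norm_eq_0_iff[OF p, of 0] subspace_0[OF subL]
        by (intro eventually_sequentiallyI[of "Suc j"]) simp
      then show "(\<lambda>M. Lp_norm p (s (ell2_unit j) M - e j)) \<longlonglongrightarrow> 0"
        by (rule tendsto_eventually)
    qed (rule e)
    then show "\<forall>j. T (ell2_unit j) = e j"
      by blast
  qed
qed

text \<open>By linearity the two norm estimates make \<open>T\<close> bi-Lipschitz. The range is
  closed because a convergent sequence in it pulls back to a Cauchy sequence in the complete space
  \<open>ell2\<close>.\<close>

lemma range_isomorphic_closed:
  fixes T :: "ell2 \<Rightarrow> L0"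
  assumes p: "1 \<le> p" and T: "linear T" "\<And>y. T y \<in> Lp p" and c: "0 < c" and C: "0 < C"
    and lower: "\<And>y. c * norm y \<le> Lp_norm p (T y)" and upper: "\<And>y. Lp_norm p (T y) \<le> C * norm y"
  shows "closed_subspace_Lp p (range T)" "isomorphic_to_ell2 p (range T)"
proof -
  interpret L: Metric_space "Lp p" "Lp_dist p"
    by (rule Metric_space_Lp[OF p])
  have RT: "range T \<subseteq> Lp p"
    using T by auto
  interpret S: Submetric "Lp p" "Lp_dist p" "range T"
    by unfold_locales (rule RT)
  have dist_lower: "c * dist y z \<le> Lp_dist p (T y) (T z)" for y z
    using lower[of "y - z"] by (simp add: dist_norm linear_diff[OF T(1)])
  have dist_upper: "Lp_dist p (T y) (T z) \<le> C * dist y z" for y z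
    using upper[of "y - z"] by (simp add: dist_norm linear_diff[OF T(1)])
  have inj: "inj T"
  proof (rule injI)
    fix y z assume "T y = T z"
    then have "c * dist y z \<le> 0"
      using dist_lower[of y z] Lp_norm_eq_0_iff[OF p, of 0] subspace_0[OF subspace_Lp[OF p]] by simp
    then show "y = z"
      using c by (simp add: mult_le_0_iff)
  qed
  have top: "subtopology (Lp_topology p) (range T) = S.sub.mtopology"
    by (simp add: Lp_topology_def S.mtopology_submetric)
  have "homeomorphic_maps euclidean S.sub.mtopology T (inv T)"
    unfolding homeomorphic_maps_def
  proof (intro conjI)
    show "continuous_map euclidean S.sub.mtopology T"
      unfolding mtopology_is_euclidean[symmetric] Met_TC.metric_continuous_map[OF S.sub.Metric_space_axioms]
    proof (intro conjI ballI allI impI)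
      fix a \<epsilon> assume "0 < (\<epsilon> :: real)"
      then show "\<exists>\<delta>>0. \<forall>x. x \<in> UNIV \<and> dist a x < \<delta> \<longrightarrow> Lp_dist p (T a) (T x) < \<epsilon>"
        using C le_less_trans[OF dist_upper]
        by (intro exI[of _ "\<epsilon> / C"]) (auto simp: field_simps)
    qed auto
    show "continuous_map S.sub.mtopology euclidean (inv T)"
      unfolding mtopology_is_euclidean[symmetric] S.sub.metric_continuous_map[OF Met_TC.Metric_space_axioms]
    proof (intro conjI ballI allI impI)
      fix a \<epsilon> assume a: "a \<in> range T" and "0 < (\<epsilon> :: real)"
      have "dist (inv T a) (inv T x) < \<epsilon>" if "x \<in> range T" "Lp_dist p a x < \<epsilon> * c" for x
      proof -
        have "c * dist (inv T a) (inv T x) < c * \<epsilon>"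
          using dist_lower[of "inv T a" "inv T x"] that a by (simp add: f_inv_into_f mult.commute)
        then show ?thesis
          using c by simp
      qed
      then show "\<exists>\<delta>>0. \<forall>x. x \<in> range T \<and> Lp_dist p a x < \<delta> \<longrightarrow> dist (inv T a) (inv T x) < \<epsilon>"
        using c \<open>0 < \<epsilon>\<close> by (intro exI[of _ "\<epsilon> * c"]) auto
    qed auto
  qed (auto simp: inj f_inv_into_f)
  then show "isomorphic_to_ell2 p (range T)"
    unfolding isomorphic_to_ell2_def top using T(1) homeomorphic_maps_imp_map by blast
  have "closedin L.mtopology (range T)"
    unfolding L.metric_closedin_iff_sequentially_closed
  proof (intro conjI allI impI RT)
    fix \<sigma> l assume "range \<sigma> \<subseteq> range T \<and> limitin L.mtopology \<sigma> l sequentially"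
    then have \<sigma>: "\<And>n. \<sigma> n \<in> range T" and l: "l \<in> Lp p"
      and lim: "\<And>d. 0 < d \<Longrightarrow> \<exists>N. \<forall>n\<ge>N. Lp_dist p (\<sigma> n) l < d"
      unfolding L.limit_metric_sequentially by blast+
    define y where "y n = inv T (\<sigma> n)" for n
    have Ty: "T (y n) = \<sigma> n" for n
      using \<sigma> by (simp add: y_def f_inv_into_f)
    have "Cauchy y"
    proof (rule metric_CauchyI)
      fix d :: real assume "0 < d"
      then obtain N where N: "\<forall>n\<ge>N. Lp_dist p (\<sigma> n) l < c * d / 2"
        using lim[of "c * d / 2"] c by auto
      have "dist (y m) (y n) < d" if "m \<ge> N" "n \<ge> N" for m n
      proof -
        have "c * dist (y m) (y n) \<le> Lp_dist p (\<sigma> m) (\<sigma> n)"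
          using dist_lower[of "y m" "y n"] by (simp add: Ty)
        also have "\<dots> \<le> Lp_dist p (\<sigma> m) l + Lp_dist p l (\<sigma> n)"
          using l \<sigma> RT by (intro L.triangle) auto
        also have "\<dots> < c * d / 2 + c * d / 2"
          using N that by (intro add_strict_mono) (auto simp: Lp_norm_minus_commute[OF p, of l "\<sigma> n"])
        finally show ?thesis
          using c by simp
      qed
      then show "\<exists>N. \<forall>m\<ge>N. \<forall>n\<ge>N. dist (y m) (y n) < d"
        by blast
    qed
    then obtain z where z: "y \<longlonglongrightarrow> z"
      by (rule ell2_complete)
    have "(\<lambda>n. Lp_norm p (\<sigma> n - T z)) \<longlonglongrightarrow> 0"
    proof (rule Lim_null_comparison)
      show "\<forall>\<^sub>F n in sequentially. norm (Lp_norm p (\<sigma> n - T z)) \<le> C * dist (y n) z"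
        using dist_upper by (simp add: Ty[symmetric] Lp_norm_nonneg)
      show "(\<lambda>n. C * dist (y n) z) \<longlonglongrightarrow> 0"
        using z by (intro tendsto_mult_right_zero) (simp add: tendsto_dist_iff[symmetric])
    qed
    moreover have "(\<lambda>n. Lp_norm p (\<sigma> n - l)) \<longlonglongrightarrow> 0"
      using lim by (intro LIMSEQ_I) (simp add: Lp_norm_nonneg)
    ultimately have "T z = l"
      using \<sigma> RT l T by (intro Lp_limit_unique[OF p, of \<sigma>]) auto
    then show "l \<in> range T"
      by blast
  qed
  then show "closed_subspace_Lp p (range T)"
    using RT linear_subspace_image[OF T(1) subspace_UNIV] by (simp add: closed_subspace_Lp_def Lp_topology_def)
qed

section \<open>Gluing the blocks\<close>

text \<open>With \<open>n\<close> of order \<open>N powr \<theta>\<close> and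
  \<open>N = 2 ^ m\<close>, the logarithm of the size of the net is of order
  \<open>N powr \<theta> * ln N\<close>. As \<open>\<theta> < 1\<close>, the linear term
  \<open>N * ln (9 / 10)\<close> wins for every \<open>b\<close>.\<close>

lemma ex_block_size:
  fixes b \<theta> :: real
  assumes "0 < b" "0 < \<theta>" "\<theta> < 1"
  obtains m n :: nat where "1 \<le> n" "2 * (45 * real n) ^ n * (9 / 10 :: real) ^ (2 ^ m) < 1"
    "b * (2 ^ m) powr \<theta> \<le> real n"
proof -
  have "eventually (\<lambda>N. ln 2 + (b * N powr \<theta> + 2) * ln (45 * (b * N powr \<theta> + 2)) + N * ln (9 / 10) < 0) at_top"
    using assms by real_asymp
  moreover have "filterlim (\<lambda>m. 2 ^ m :: real) at_top sequentially"
    by real_asymp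
  ultimately have "eventually (\<lambda>m. ln 2 + (b * (2 ^ m) powr \<theta> + 2) * ln (45 * (b * (2 ^ m) powr \<theta> + 2)) +
      2 ^ m * ln (9 / 10) < 0) sequentially"
    by (rule eventually_compose_filterlim)
  then obtain m where m: "ln 2 + (b * (2 ^ m) powr \<theta> + 2) * ln (45 * (b * (2 ^ m) powr \<theta> + 2)) +
      2 ^ m * ln (9 / 10) < (0 :: real)"
    by (auto simp: eventually_sequentially)
  define r where "r = b * (2 ^ m) powr \<theta>"
  \<comment> \<open>The \<open>+ 1\<close> gives \<open>1 <= n\<close> at once, and the resulting
    \<open>n <= r + 2\<close> explains the shift by 2 in the limit above.\<close>
  define n where "n = nat \<lceil>r\<rceil> + 1"
  have "0 \<le> r"
    using assms by (simp add: r_def)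
  then have n: "1 \<le> n" "r \<le> real n" "real n \<le> r + 2"
    unfolding n_def by linarith+
  have "2 * (45 * real n) ^ n * (9 / 10 :: real) ^ (2 ^ m) =
      exp (ln 2 + n * ln (45 * real n) + 2 ^ m * ln (9 / 10))"
    using n exp_of_nat_mult[of "2 ^ m" "ln (9 / 10) :: real"] exp_of_nat_mult[of n "ln (45 * real n)"]
    by (simp add: exp_add)
  also have "\<dots> \<le> exp (ln 2 + (r + 2) * ln (45 * (r + 2)) + 2 ^ m * ln (9 / 10))"
  proof -
    have "real n * ln (45 * real n) \<le> (r + 2) * ln (45 * (r + 2))"
      using n by (intro mult_mono ln_mono) auto
    then show ?thesis
      by simp
  qed
  also have "\<dots> < 1"
    using m by (simp add: r_def)
  finally show thesis
    using n by (intro that[of n m]) (auto simp: r_def)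
qed

text \<open>
  The even-numbered digits of a point of the unit interval serve as a common probability space for
  all blocks; the odd-numbered ones supply the independent signs that separate the blocks.
\<close>

definition evens :: "nat \<Rightarrow> nat set" where
  "evens m = (\<lambda>i. 2 * i) ` {..<m}"

lemma finite_evens [simp]: "finite (evens m)"
  by (simp add: evens_def)

lemma card_evens: "card (evens m) = m"
  by (simp add: evens_def card_image inj_on_def)

lemma odd_notin_evens: "2 * b + 1 \<notin> evens m"
  unfolding evens_def by auto presburger

text \<open>Fix the even digits and average over the odd ones first. For the squares the mixed terms
  vanish; for the absolute values Khinchine's inequality leaves the square function of the blocks.
  No independence between the functions \<open>h b\<close> enters, only that of the odd
  signs.\<close>

lemma signed_blocks_moments:
  fixes h :: "nat \<Rightarrow> (nat \<Rightarrow> real) \<Rightarrow> real" and m :: "nat \<Rightarrow> nat" and B :: "nat set"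
  assumes B: "finite B"
  defines "S \<equiv> (\<Union>b\<in>B. evens (m b)) \<union> (\<lambda>b. 2 * b + 1) ` B"
    and "g \<equiv> (\<lambda>a. \<Sum>b\<in>B. a (2 * b + 1) * h b (restrict a (evens (m b))))"
  shows "savg S (\<lambda>a. (g a)\<^sup>2) = (\<Sum>b\<in>B. savg (evens (m b)) (\<lambda>a. (h b a)\<^sup>2))"
    and "9 / 16 * sqrt (\<Sum>b\<in>B. (savg (evens (m b)) (\<lambda>a. \<bar>h b a\<bar>))\<^sup>2) \<le> savg S (\<lambda>a. \<bar>g a\<bar>)"
proof -
  define I where "I = (\<Union>b\<in>B. evens (m b))"
  define J where "J = (\<lambda>b. 2 * b + 1) ` B"
  have fin: "finite I" "finite J"
    using B by (auto simp: I_def J_def)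
  have disj: "I \<inter> J = {}"
    using odd_notin_evens by (auto simp: I_def J_def)
  have I: "evens (m b) \<subseteq> I" if "b \<in> B" for b
    using that by (auto simp: I_def)
  \<comment> \<open>Indexed by odd digits instead of blocks, since the moment lemmas sum over the
    signs themselves; \<open>j div 2\<close> recovers the block.\<close>
  define v where "v a j = h (j div 2) (restrict a (evens (m (j div 2))))" for a :: "nat \<Rightarrow> real" and j
  have g_merge: "g (\<lambda>j. if j \<in> J then s j else a j) = (\<Sum>j\<in>J. v a j * s j)" for a s
  proof -
    have "(\<Sum>j\<in>J. v a j * s j) = (\<Sum>b\<in>B. v a (2 * b + 1) * s (2 * b + 1))"
      unfolding J_def by (subst sum.reindex) (auto simp: inj_on_def)
    also have "\<dots> = g (\<lambda>j. if j \<in> J then s j else a j)"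
      unfolding g_def
    proof (intro sum.cong refl)
      fix b assume b: "b \<in> B"
      have "restrict (\<lambda>j. if j \<in> J then s j else a j) (evens (m b)) = restrict a (evens (m b))"
        using I[OF b] disj by (auto simp: restrict_def fun_eq_iff)
      then show "v a (2 * b + 1) * s (2 * b + 1) = (if 2 * b + 1 \<in> J then s (2 * b + 1) else a (2 * b + 1)) *
          h b (restrict (\<lambda>j. if j \<in> J then s j else a j) (evens (m b)))"
        using b by (simp add: v_def J_def)
    qed
    finally show ?thesis ..
  qed
  have savg_S: "savg S (\<lambda>a. \<phi> (g a)) = savg I (\<lambda>a. savg J (\<lambda>s. \<phi> (\<Sum>j\<in>J. v a j * s j)))" for \<phi> :: "real \<Rightarrow> real"
    unfolding S_def I_def[symmetric] J_def[symmetric] by (subst savg_Un[OF fin disj]) (simp add: g_merge)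
  have sum_J: "(\<Sum>j\<in>J. (v a j)\<^sup>2) = (\<Sum>b\<in>B. (h b (restrict a (evens (m b))))\<^sup>2)" for a
    unfolding J_def by (subst sum.reindex) (auto simp: inj_on_def v_def)
  show "savg S (\<lambda>a. (g a)\<^sup>2) = (\<Sum>b\<in>B. savg (evens (m b)) (\<lambda>a. (h b a)\<^sup>2))"
    using I unfolding savg_S[of "\<lambda>t. t\<^sup>2"]
    by (simp add: savg_sum_square fin sum_J savg_sum savg_restrict[of I "evens (m b)" "\<lambda>a. (h b a)\<^sup>2" for b])
  define c where "c b = savg (evens (m b)) (\<lambda>a. \<bar>h b a\<bar>)" for b
  define r where "r = sqrt (\<Sum>b\<in>B. (c b)\<^sup>2)"
  define H where "H a = sqrt (\<Sum>b\<in>B. (h b (restrict a (evens (m b))))\<^sup>2)" for a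
  \<comment> \<open>The aim is \<open>r <= savg I H\<close>: the Euclidean norm of a vector of means
    is at most the mean of the Euclidean norms. Pairing with the vector \<open>c\<close> of means
    itself proves it.\<close>
  have "r * r = (\<Sum>b\<in>B. c b * c b)"
    by (simp add: r_def sum_nonneg power2_eq_square)
  also have "\<dots> = (\<Sum>b\<in>B. c b * savg I (\<lambda>a. \<bar>h b (restrict a (evens (m b)))\<bar>))"
    using I fin by (intro sum.cong) (auto simp: c_def savg_restrict[of I "evens (m b)" "\<lambda>a. \<bar>h b a\<bar>" for b])
  also have "\<dots> = savg I (\<lambda>a. \<Sum>b\<in>B. c b * \<bar>h b (restrict a (evens (m b)))\<bar>)"
    by (simp add: savg_sum savg_cmult)
  also have "\<dots> \<le> savg I (\<lambda>a. r * H a)"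
  proof (rule savg_mono)
    fix a
    have "(\<Sum>b\<in>B. c b * \<bar>h b (restrict a (evens (m b)))\<bar>) \<le>
        (\<Sum>b\<in>B. \<bar>c b\<bar> * \<bar>h b (restrict a (evens (m b)))\<bar>)"
      by (intro sum_mono mult_right_mono) auto
    also have "\<dots> \<le> L2_set c B * L2_set (\<lambda>b. h b (restrict a (evens (m b)))) B"
      by (rule L2_set_mult_ineq)
    finally show "(\<Sum>b\<in>B. c b * \<bar>h b (restrict a (evens (m b)))\<bar>) \<le> r * H a"
      by (simp add: L2_set_def r_def H_def)
  qed
  also have "\<dots> = r * savg I H"
    by (rule savg_cmult)
  finally have "r * r \<le> r * savg I H" .
  moreover have "0 \<le> savg I H"
    unfolding savg_def by (intro divide_nonneg_nonneg sum_nonneg) (auto simp: H_def sum_nonneg)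
  moreover have "0 \<le> r"
    by (simp add: r_def sum_nonneg)
  ultimately have "r \<le> savg I H"
    by (cases "r = 0") auto
  then have "9 / 16 * r \<le> 9 / 16 * savg I H"
    by simp
  also have "\<dots> = savg I (\<lambda>a. 9 / 16 * H a)"
    by (rule savg_cmult [symmetric])
  also have "\<dots> \<le> savg I (\<lambda>a. savg J (\<lambda>s. \<bar>\<Sum>j\<in>J. v a j * s j\<bar>))"
    using khinchine_lower[OF fin(2)] by (intro savg_mono) (simp add: H_def sum_J[symmetric])
  also have "\<dots> = savg S (\<lambda>a. \<bar>g a\<bar>)"
    by (rule savg_S [symmetric])
  finally show "9 / 16 * sqrt (\<Sum>b\<in>B. (savg (evens (m b)) (\<lambda>a. \<bar>h b a\<bar>))\<^sup>2) \<le> savg S (\<lambda>a. \<bar>g a\<bar>)"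
    by (simp add: r_def c_def)
qed

section \<open>\<open>Lp\<close> norms of functions of finitely many digits\<close>

lemma rads_in_Lp:
  fixes g :: "(nat \<Rightarrow> real) \<Rightarrow> real"
  assumes "finite S"
  shows "abs_L0 (\<lambda>x. g (rads S x)) \<in> Lp p"
  by (simp add: abs_L0_in_Lp_iff[OF rads_measurable_unit_leb[OF assms]] integrable_rads[OF assms, of "\<lambda>a. \<bar>g a\<bar> powr p"])

lemma Lp_norm_rads:
  fixes g :: "(nat \<Rightarrow> real) \<Rightarrow> real"
  assumes "finite S"
  shows "Lp_norm p (abs_L0 (\<lambda>x. g (rads S x))) = savg S (\<lambda>a. \<bar>g a\<bar> powr p) powr (1 / p)"
  by (simp add: Lp_norm_abs_L0[OF rads_measurable_unit_leb[OF assms]] integral_rads[OF assms, of "\<lambda>a. \<bar>g a\<bar> powr p"])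

text \<open>After scaling by \<open>s\<close>, the pointwise bound
  \<open>t powr p <= 1 + t\<^sup>2\<close> gives a p-th moment of at most 2, hence at most
  \<open>2 powr p\<close>; this is the source of the factor 2.\<close>

lemma Lp_norm_rads_le:
  fixes g :: "(nat \<Rightarrow> real) \<Rightarrow> real"
  assumes S: "finite S" and p: "1 \<le> p" "p \<le> 2" and s: "0 < s" and le: "savg S (\<lambda>a. (g a)\<^sup>2) \<le> s\<^sup>2"
  shows "Lp_norm p (abs_L0 (\<lambda>x. g (rads S x))) \<le> 2 * s"
proof -
  have pw: "t powr p \<le> 1 + t\<^sup>2" if "0 \<le> t" for t :: real
  proof (cases "t \<le> 1")
    case True
    then have "t powr p \<le> 1 powr p"
      using that p by (intro powr_mono2) auto
    then show ?thesis
      by (simp add: add_increasing2)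
  next
    case False
    then have "t powr p \<le> t powr 2"
      using p by (intro powr_mono) auto
    then show ?thesis
      using False by (simp add: powr_numeral)
  qed
  have "savg S (\<lambda>a. \<bar>g a\<bar> powr p) \<le> savg S (\<lambda>a. s powr p * (1 + 1 / s\<^sup>2 * (g a)\<^sup>2))"
  proof (rule savg_mono)
    fix a
    have "\<bar>g a\<bar> powr p = (s * (\<bar>g a\<bar> / s)) powr p"
      using s by simp
    also have "\<dots> = s powr p * (\<bar>g a\<bar> / s) powr p"
      using s by (intro powr_mult)
    also have "\<dots> \<le> s powr p * (1 + (\<bar>g a\<bar> / s)\<^sup>2)"
      using s by (intro mult_left_mono pw) auto
    finally show "\<bar>g a\<bar> powr p \<le> s powr p * (1 + 1 / s\<^sup>2 * (g a)\<^sup>2)"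
      by (simp add: power_divide)
  qed
  also have "\<dots> = s powr p * (1 + 1 / s\<^sup>2 * savg S (\<lambda>a. (g a)\<^sup>2))"
    by (simp only: savg_cmult savg_add savg_const[OF S])
  also have "\<dots> \<le> s powr p * 2"
    using le s by (intro mult_left_mono) auto
  also have "\<dots> \<le> s powr p * 2 powr p"
    using powr_mono[of 1 p 2] p by (intro mult_left_mono) auto
  also have "\<dots> = (2 * s) powr p"
    using s by (simp add: powr_mult)
  finally have "savg S (\<lambda>a. \<bar>g a\<bar> powr p) powr (1 / p) \<le> ((2 * s) powr p) powr (1 / p)"
    using p by (intro powr_mono2) (auto simp: savg_def intro!: divide_nonneg_nonneg sum_nonneg)
  then show ?thesis
    using s p by (simp add: Lp_norm_rads[OF S] powr_powr)
qed

text \<open>Taking half of \<open>l\<close> as threshold in \<open>abs_le_add_powr\<close> leaves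
  the other half to be carried by the p-th moment.\<close>

lemma Lp_norm_rads_ge:
  fixes g :: "(nat \<Rightarrow> real) \<Rightarrow> real"
  assumes S: "finite S" and p: "1 \<le> p" and l: "0 < l" and le: "l \<le> savg S (\<lambda>a. \<bar>g a\<bar>)"
  shows "l / 2 \<le> Lp_norm p (abs_L0 (\<lambda>x. g (rads S x)))"
proof -
  define \<delta> where "\<delta> = l / 2"
  have \<delta>: "0 < \<delta>" "l = 2 * \<delta>"
    using l by (auto simp: \<delta>_def)
  have "2 * \<delta> \<le> savg S (\<lambda>a. \<bar>g a\<bar>)"
    using le \<delta>(2) by simp
  also have "\<dots> \<le> savg S (\<lambda>a. \<delta> + \<delta> powr (1 - p) * \<bar>g a\<bar> powr p)"
    by (intro savg_mono abs_le_add_powr p \<delta>)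
  also have "\<dots> = \<delta> + \<delta> powr (1 - p) * savg S (\<lambda>a. \<bar>g a\<bar> powr p)"
    by (simp only: savg_add savg_cmult savg_const[OF S])
  finally have "\<delta> powr (p - 1) * \<delta> \<le> \<delta> powr (p - 1) * (\<delta> powr (1 - p) * savg S (\<lambda>a. \<bar>g a\<bar> powr p))"
    by (intro mult_left_mono) auto
  also have "\<delta> powr (p - 1) * \<delta> = \<delta> powr p"
    using \<delta>(1) by (simp add: powr_diff)
  also have "\<delta> powr (p - 1) * (\<delta> powr (1 - p) * savg S (\<lambda>a. \<bar>g a\<bar> powr p)) = savg S (\<lambda>a. \<bar>g a\<bar> powr p)"
    using \<delta>(1) by (simp add: mult.assoc[symmetric] powr_add[symmetric])
  finally have "(\<delta> powr p) powr (1 / p) \<le> savg S (\<lambda>a. \<bar>g a\<bar> powr p) powr (1 / p)"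
    using p by (intro powr_mono2) auto
  then show ?thesis
    using \<delta> p by (simp add: Lp_norm_rads[OF S] powr_powr)
qed

text \<open>Block \<open>b\<close> is a sign matrix with \<open>n b\<close> columns whose rows are
  indexed by the \<open>2 ^ m b\<close> atoms, that is, by the values of the first
  \<open>m b\<close> even digits. The constants 20 and 17 are those of
  \<open>ex_sign_matrix\<close>, with sums over rows turned into averages.\<close>

locale sign_blocks =
  fixes m n :: "nat \<Rightarrow> nat" and A :: "nat \<Rightarrow> (nat \<Rightarrow> real) \<Rightarrow> nat \<Rightarrow> real"
  assumes n_pos: "1 \<le> n b"
    and A_signs: "a \<in> signs (evens (m b)) \<Longrightarrow> A b a \<in> signs {..<n b}"
    and lower: "sqrt (\<Sum>k<n b. (x k)\<^sup>2) \<le> 20 * savg (evens (m b)) (\<lambda>a. \<bar>\<Sum>k<n b. x k * A b a k\<bar>)"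
    and upper: "savg (evens (m b)) (\<lambda>a. (\<Sum>k<n b. x k * A b a k)\<^sup>2) \<le> 17 * (\<Sum>k<n b. (x k)\<^sup>2)"
begin

definition idx :: "(nat \<times> nat) set" where
  "idx = (SIGMA b:UNIV. {..<n b})"

definition fn :: "nat \<times> nat \<Rightarrow> real \<Rightarrow> real" where
  "fn = (\<lambda>(b, k) x. rad (2 * b + 1) x * A b (rads (evens (m b)) x) k)"

lemma fn_eq_rads: "fn (b, k) x = (\<lambda>a. a (2 * b + 1) * A b (restrict a (evens (m b))) k)
    (rads (insert (2 * b + 1) (evens (m b))) x)"
  by (simp add: fn_def restrict_rads rads_apply subset_insertI)

lemma fn_measurable: "fn q \<in> borel_measurable unit_leb"
proof (cases q)
  case (Pair b k)
  show ?thesis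
    using rads_measurable_unit_leb[of "insert (2 * b + 1) (evens (m b))" "\<lambda>a. a (2 * b + 1) * A b (restrict a (evens (m b))) k"]
    by (simp add: Pair fn_eq_rads[abs_def])
qed

lemma fn_in_Lp: "abs_L0 (fn q) \<in> Lp p"
proof (cases q)
  case (Pair b k)
  show ?thesis
    using rads_in_Lp[of "insert (2 * b + 1) (evens (m b))" "\<lambda>a. a (2 * b + 1) * A b (restrict a (evens (m b))) k"]
    by (simp add: Pair fn_eq_rads[abs_def])
qed

lemma norm_estimates:
  fixes y :: "nat \<times> nat \<Rightarrow> real"
  assumes p: "1 \<le> p" "p \<le> 2" and K: "finite K" "K \<subseteq> idx"
  shows "1 / 80 * sqrt (\<Sum>q\<in>K. (y q)\<^sup>2) \<le> Lp_norm p (\<Sum>q\<in>K. y q *\<^sub>R abs_L0 (fn q))"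
    and "Lp_norm p (\<Sum>q\<in>K. y q *\<^sub>R abs_L0 (fn q)) \<le> 10 * sqrt (\<Sum>q\<in>K. (y q)\<^sup>2)"
proof -
  define N2 where "N2 = (\<Sum>q\<in>K. (y q)\<^sup>2)"
  have "1 / 80 * sqrt N2 \<le> Lp_norm p (\<Sum>q\<in>K. y q *\<^sub>R abs_L0 (fn q)) \<and>
    Lp_norm p (\<Sum>q\<in>K. y q *\<^sub>R abs_L0 (fn q)) \<le> 10 * sqrt N2"
  proof (cases "N2 = 0")
    case True
    then have "y q = 0" if "q \<in> K" for q
      using that K unfolding N2_def by (subst (asm) sum_nonneg_eq_0_iff) auto
    then show ?thesis
      using True Lp_norm_eq_0_iff[OF p(1), of 0] subspace_0[OF subspace_Lp[OF p(1)]] by simp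
  next
    case False
    then have N2: "0 < N2"
      using sum_nonneg[of K "\<lambda>q. (y q)\<^sup>2"] by (auto simp: N2_def less_le)
    define B where "B = fst ` K"
    have B: "finite B"
      using K by (simp add: B_def)
    \<comment> \<open>The coefficients are extended by zero from \<open>K\<close> to the full
      blocks, because the matrix estimates concern all columns of a block.\<close>
    define x where "x b k = (if (b, k) \<in> K then y (b, k) else 0)" for b k
    define h where "h b a = (\<Sum>k<n b. x b k * A b a k)" for b a
    have regroup: "(\<Sum>q\<in>K. f q) = (\<Sum>b\<in>B. \<Sum>k<n b. if (b, k) \<in> K then f (b, k) else 0)" for f :: "nat \<times> nat \<Rightarrow> real"
    proof -
      have "(\<Sum>q\<in>K. f q) = (\<Sum>q\<in>(SIGMA b:B. {..<n b}). if q \<in> K then f q else 0)"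
        using K B by (intro sum.mono_neutral_cong_left) (force simp: idx_def B_def)+
      also have "\<dots> = (\<Sum>b\<in>B. \<Sum>k<n b. if (b, k) \<in> K then f (b, k) else 0)"
        using B by (subst sum.Sigma) (auto intro!: sum.cong)
      finally show ?thesis .
    qed
    define S where "S = (\<Union>b\<in>B. evens (m b)) \<union> (\<lambda>b. 2 * b + 1) ` B"
    have S: "finite S"
      using B by (simp add: S_def)
    define g where "g a = (\<Sum>b\<in>B. a (2 * b + 1) * h b (restrict a (evens (m b))))" for a :: "nat \<Rightarrow> real"
    have "(\<Sum>q\<in>K. y q * fn q t) = g (rads S t)" for t
    proof -
      have "(\<Sum>q\<in>K. y q * fn q t) = (\<Sum>b\<in>B. \<Sum>k<n b. x b k * fn (b, k) t)"
        unfolding regroup x_def by (intro sum.cong) auto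
      also have "\<dots> = (\<Sum>b\<in>B. rads S t (2 * b + 1) * h b (restrict (rads S t) (evens (m b))))"
      proof (intro sum.cong refl)
        fix b assume "b \<in> B"
        then have "evens (m b) \<subseteq> S" "2 * b + 1 \<in> S"
          by (auto simp: S_def)
        then show "(\<Sum>k<n b. x b k * fn (b, k) t) = rads S t (2 * b + 1) * h b (restrict (rads S t) (evens (m b)))"
          by (simp add: rads_apply restrict_rads h_def fn_def sum_distrib_left mult_ac)
      qed
      finally show ?thesis
        by (simp add: g_def)
    qed
    then have G: "(\<Sum>q\<in>K. y q *\<^sub>R abs_L0 (fn q)) = abs_L0 (\<lambda>t. g (rads S t))"
      using abs_L0_lincomb[of K fn y, OF K(1) fn_measurable] by simp
    have x2: "(\<Sum>b\<in>B. \<Sum>k<n b. (x b k)\<^sup>2) = N2"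
      unfolding N2_def regroup x_def by (intro sum.cong) auto
    have "savg S (\<lambda>a. (g a)\<^sup>2) = (\<Sum>b\<in>B. savg (evens (m b)) (\<lambda>a. (h b a)\<^sup>2))"
      unfolding S_def g_def by (rule signed_blocks_moments(1)[OF B])
    also have "\<dots> \<le> (\<Sum>b\<in>B. 17 * (\<Sum>k<n b. (x b k)\<^sup>2))"
      unfolding h_def by (intro sum_mono upper)
    \<comment> \<open>Here 17 is rounded up to 25; with the factor 2 of
      \<open>Lp_norm_rads_le\<close> this gives 10.\<close>
    also have "\<dots> \<le> (5 * sqrt N2)\<^sup>2"
      using N2 by (simp add: x2 sum_distrib_left[symmetric] power_mult_distrib)
    finally have up: "Lp_norm p (abs_L0 (\<lambda>t. g (rads S t))) \<le> 2 * (5 * sqrt N2)"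
      using N2 by (intro Lp_norm_rads_le[OF S p]) auto
    \<comment> \<open>The matrix bound 1/20 times Khinchine's 9/16 is 9/320, which is above 1/40;
      \<open>Lp_norm_rads_ge\<close> halves this to 1/80.\<close>
    have "1 / 40 * sqrt N2 \<le> 9 / 16 * sqrt (N2 / 400)"
      using N2 by (simp add: real_sqrt_divide)
    also have "N2 / 400 = (\<Sum>b\<in>B. (sqrt (\<Sum>k<n b. (x b k)\<^sup>2) / 20)\<^sup>2)"
      by (simp add: power_divide sum_nonneg sum_divide_distrib[symmetric] x2)
    also have "9 / 16 * sqrt \<dots> \<le> 9 / 16 * sqrt (\<Sum>b\<in>B. (savg (evens (m b)) (\<lambda>a. \<bar>h b a\<bar>))\<^sup>2)"
      using lower by (intro mult_left_mono real_sqrt_le_mono sum_mono power_mono)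
        (auto simp: h_def sum_nonneg field_simps)
    also have "\<dots> \<le> savg S (\<lambda>a. \<bar>g a\<bar>)"
      unfolding S_def g_def by (rule signed_blocks_moments(2)[OF B])
    finally have "1 / 40 * sqrt N2 / 2 \<le> Lp_norm p (abs_L0 (\<lambda>t. g (rads S t)))"
      using N2 by (intro Lp_norm_rads_ge[OF S p(1)]) auto
    with up show ?thesis
      unfolding G by simp
  qed
  then show "1 / 80 * sqrt (\<Sum>q\<in>K. (y q)\<^sup>2) \<le> Lp_norm p (\<Sum>q\<in>K. y q *\<^sub>R abs_L0 (fn q))"
    "Lp_norm p (\<Sum>q\<in>K. y q *\<^sub>R abs_L0 (fn q)) \<le> 10 * sqrt (\<Sum>q\<in>K. (y q)\<^sup>2)"
    by (simp_all add: N2_def)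
qed

lemma idx_enumeration:
  obtains \<beta> :: "nat \<Rightarrow> nat \<times> nat" where "bij_betw \<beta> UNIV idx"
proof -
  have "inj (\<lambda>b :: nat. (b, 0 :: nat))" "range (\<lambda>b. (b, 0)) \<subseteq> idx"
    using n_pos by (auto simp: inj_def idx_def Suc_le_eq)
  then have "infinite idx"
    by (meson finite_subset infinite_UNIV_nat finite_imageD)
  then show thesis
    by (intro that[of "from_nat_into idx"] bij_betw_from_nat_into) auto
qed

text \<open>The indicator carries the sign of its block, so that each \<open>fn (b, k)\<close> is
  exactly a combination of atoms; the sign leaves the absolute value, and hence the norm,
  unchanged.\<close>

definition atom :: "nat \<Rightarrow> (nat \<Rightarrow> real) \<Rightarrow> real \<Rightarrow> real" where
  "atom b a x = rad (2 * b + 1) x * (if rads (evens (m b)) x = a then 1 else 0)"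

lemma atom_eq_rads: "atom b a x = (\<lambda>c. c (2 * b + 1) * (if restrict c (evens (m b)) = a then 1 else 0))
    (rads (insert (2 * b + 1) (evens (m b))) x)"
  by (simp add: atom_def restrict_rads rads_apply subset_insertI)

lemma atom_measurable: "atom b a \<in> borel_measurable unit_leb"
  using rads_measurable_unit_leb[of "insert (2 * b + 1) (evens (m b))"
    "\<lambda>c. c (2 * b + 1) * (if restrict c (evens (m b)) = a then 1 else 0)"]
  by (simp add: atom_eq_rads[abs_def])

lemma atom_in_Lp: "abs_L0 (atom b a) \<in> Lp p"
  using rads_in_Lp[of "insert (2 * b + 1) (evens (m b))"
    "\<lambda>c. c (2 * b + 1) * (if restrict c (evens (m b)) = a then 1 else 0)"]
  by (simp add: atom_eq_rads[abs_def])

lemma Lp_norm_atom: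
  assumes "1 \<le> p" "a \<in> signs (evens (m b))"
  shows "Lp_norm p (abs_L0 (atom b a)) = (1 / 2 ^ m b) powr (1 / p)"
proof -
  have "\<bar>atom b a x\<bar> powr p = (if rads (evens (m b)) x = a then 1 else 0)" for x
    using rad_cases[of "2 * b + 1" x] by (auto simp: atom_def)
  then have "(\<integral>x. \<bar>atom b a x\<bar> powr p \<partial>unit_leb) = savg (evens (m b)) (\<lambda>c. if c = a then 1 else 0)"
    using integral_rads[of "evens (m b)" "\<lambda>c. if c = a then 1 else 0"] by simp
  also have "\<dots> = 1 / 2 ^ m b"
    using assms by (simp add: savg_def card_evens)
  finally show ?thesis
    by (simp add: Lp_norm_abs_L0[OF atom_measurable])
qed

lemma fn_eq_sum_atoms:
  "abs_L0 (fn (b, k)) = (\<Sum>a\<in>signs (evens (m b)). A b a k *\<^sub>R abs_L0 (atom b a))"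
proof -
  have "fn (b, k) x = (\<Sum>a\<in>signs (evens (m b)). A b a k * atom b a x)" for x
  proof -
    have "(\<Sum>a\<in>signs (evens (m b)). A b a k * atom b a x) =
        (\<Sum>a\<in>signs (evens (m b)). if rads (evens (m b)) x = a then A b a k * rad (2 * b + 1) x else 0)"
      by (intro sum.cong) (auto simp: atom_def)
    also have "\<dots> = fn (b, k) x"
      using rads_in_signs by (simp add: fn_def)
    finally show ?thesis ..
  qed
  then have "fn (b, k) = (\<lambda>x. \<Sum>a\<in>signs (evens (m b)). A b a k * atom b a x)"
    by (rule ext)
  then show ?thesis
    using abs_L0_lincomb[of "signs (evens (m b))" "atom b" "\<lambda>a. A b a k", OF _ atom_measurable]
    by simp
qed

end

section \<open>Projections onto the glued space\<close>

lemma Rep_ell2_lincomb: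
  assumes "finite F"
  shows "Rep_ell2 (\<Sum>a\<in>F. c a *\<^sub>R z a) j = (\<Sum>a\<in>F. c a * Rep_ell2 (z a) j)"
  using assms by (induction F rule: finite_induct) (simp_all add: zero_ell2.rep_eq plus_ell2.rep_eq scaleR_ell2.rep_eq)

lemma bounded_linear_operator_on_lincomb:
  assumes p: "1 \<le> p" and P: "bounded_linear_operator_on p P" and F: "finite F" "\<And>a. a \<in> F \<Longrightarrow> f a \<in> Lp p"
  shows "P (\<Sum>a\<in>F. c a *\<^sub>R f a) = (\<Sum>a\<in>F. c a *\<^sub>R P (f a))"
  using F
proof (induction F rule: finite_induct)
  case empty
  have "P (0 *\<^sub>R 0) = 0 *\<^sub>R P 0"
    using P subspace_0[OF subspace_Lp[OF p]] unfolding bounded_linear_operator_on_def by blast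
  then show ?case
    by simp
next
  case (insert a F)
  have "c a *\<^sub>R f a \<in> Lp p" "(\<Sum>a\<in>F. c a *\<^sub>R f a) \<in> Lp p"
    using insert.prems by (auto intro!: subspace_scale[OF subspace_Lp[OF p]] subspace_sum[OF subspace_Lp[OF p]])
  then have "P (c a *\<^sub>R f a + (\<Sum>a\<in>F. c a *\<^sub>R f a)) = c a *\<^sub>R P (f a) + P (\<Sum>a\<in>F. c a *\<^sub>R f a)"
    using P insert.prems unfolding bounded_linear_operator_on_def by simp
  then show ?case
    using insert by simp
qed

text \<open>The sum over \<open>k\<close> of the coordinate of \<open>fn (b, k)\<close> at its own
  index is the trace of the identity on the span of block \<open>b\<close>. Since \<open>P\<close>
  fixes that span, the trace can also be computed through the images of the atoms, and the bound on
  \<open>P\<close> is applied to atoms only.\<close>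

lemma (in sign_blocks) block_size_bound_of_projection:
  fixes T :: "ell2 \<Rightarrow> L0"
  assumes p: "1 \<le> p" and \<beta>: "bij_betw \<beta> UNIV idx"
    and T: "linear T" "\<And>y. T y \<in> Lp p" "\<And>j. T (ell2_unit j) = abs_L0 (fn (\<beta> j))"
    and c: "0 < c" "\<And>y. c * norm y \<le> Lp_norm p (T y)"
    and compl: "complemented_in_Lp p (range T)"
  obtains K where "\<forall>b. real (n b) \<le> K * (2 ^ m b) powr (2 - 2 / p)"
proof -
  obtain P where P: "bounded_linear_operator_on p P" "\<forall>f\<in>Lp p. P (P f) = P f" "P ` Lp p = range T"
    using compl unfolding complemented_in_Lp_def by blast
  obtain C where C: "\<forall>f\<in>Lp p. Lp_norm p (P f) \<le> C * Lp_norm p f"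
    using P(1) unfolding bounded_linear_operator_on_def by blast
  have inj: "y = 0" if "T y = 0" for y
    using c(2)[of y] c(1) Lp_norm_eq_0_iff[OF p, of 0] subspace_0[OF subspace_Lp[OF p]] that
    by (simp add: mult_le_0_iff)
  have "real (n b) \<le> (\<bar>C\<bar> / c)\<^sup>2 * (2 ^ m b) powr (2 - 2 / p)" for b
  proof -
    define R where "R = signs (evens (m b))"
    define N where "N = (2 :: real) ^ m b"
    have N: "0 < N" "real (card R) = N"
      by (simp_all add: N_def R_def card_signs card_evens)
    have "\<exists>z. P (abs_L0 (atom b a)) = T z" for a
    proof -
      have "P (abs_L0 (atom b a)) \<in> range T"
        using P(3) atom_in_Lp[of b a p] by blast
      then show ?thesis
        by blast
    qed
    then obtain z where z: "\<And>a. P (abs_L0 (atom b a)) = T (z a)"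
      by metis
    \<comment> \<open>The norm \<open>(1 / N) powr (1 / p)\<close> of an atom, enlarged by the bound
      of \<open>P\<close> and by the inverse lower bound of \<open>T\<close>.\<close>
    define \<kappa> where "\<kappa> = \<bar>C\<bar> / c * (1 / N) powr (1 / p)"
    have norm_z: "norm (z a) \<le> \<kappa>" if "a \<in> R" for a
    proof -
      have "c * norm (z a) \<le> C * (1 / N) powr (1 / p)"
        using c(2)[of "z a"] bspec[OF C atom_in_Lp[of b a]] Lp_norm_atom[OF p that[unfolded R_def]]
        by (simp add: z N_def)
      also have "\<dots> \<le> \<bar>C\<bar> * (1 / N) powr (1 / p)"
        by (intro mult_right_mono) auto
      finally show ?thesis
        using c(1) by (simp add: \<kappa>_def field_simps)
    qed
    define \<gamma> where "\<gamma> k = inv \<beta> (b, k)" for k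
    have \<beta>\<gamma>: "\<beta> (\<gamma> k) = (b, k)" if "k < n b" for k
      using that bij_betw_imp_surj_on[OF \<beta>] by (auto simp: \<gamma>_def idx_def intro!: f_inv_into_f)
    then have \<gamma>_inj: "inj_on \<gamma> {..<n b}"
      by (intro inj_onI) (metis lessThan_iff prod.inject)
    have biorth: "1 = (\<Sum>a\<in>R. A b a k * Rep_ell2 (z a) (\<gamma> k))" if k: "k < n b" for k
    proof -
      have e: "abs_L0 (fn (b, k)) = T (ell2_unit (\<gamma> k))"
        using T(3)[of "\<gamma> k"] \<beta>\<gamma>[OF k] by simp
      have "P (abs_L0 (fn (b, k))) = abs_L0 (fn (b, k))"
      proof -
        have "abs_L0 (fn (b, k)) \<in> P ` Lp p"
          unfolding P(3) e by (rule rangeI)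
        then show ?thesis
          using P(2) by auto
      qed
      moreover have "P (abs_L0 (fn (b, k))) = (\<Sum>a\<in>R. A b a k *\<^sub>R P (abs_L0 (atom b a)))"
        unfolding fn_eq_sum_atoms R_def
        by (intro bounded_linear_operator_on_lincomb[OF p P(1)] atom_in_Lp) simp
      ultimately have "T (ell2_unit (\<gamma> k)) = T (\<Sum>a\<in>R. A b a k *\<^sub>R z a)"
        by (simp add: e z linear_sum[OF T(1)] linear_scale[OF T(1)])
      then have "ell2_unit (\<gamma> k) = (\<Sum>a\<in>R. A b a k *\<^sub>R z a)"
        using inj[of "ell2_unit (\<gamma> k) - (\<Sum>a\<in>R. A b a k *\<^sub>R z a)"] by (simp add: linear_diff[OF T(1)])
      then have "Rep_ell2 (ell2_unit (\<gamma> k)) (\<gamma> k) = Rep_ell2 (\<Sum>a\<in>R. A b a k *\<^sub>R z a) (\<gamma> k)"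
        by simp
      then show ?thesis
        by (simp add: Rep_ell2_unit Rep_ell2_lincomb R_def)
    qed
    have "real (n b) = (\<Sum>k<n b. \<Sum>a\<in>R. A b a k * Rep_ell2 (z a) (\<gamma> k))"
      using biorth by simp
    also have "\<dots> = (\<Sum>a\<in>R. \<Sum>k<n b. A b a k * Rep_ell2 (z a) (\<gamma> k))"
      by (rule sum.swap)
    also have "\<dots> \<le> (\<Sum>a\<in>R. sqrt (n b) * \<kappa>)"
    proof (rule sum_mono)
      fix a assume a: "a \<in> R"
      have "(\<Sum>k<n b. A b a k * Rep_ell2 (z a) (\<gamma> k)) \<le> (\<Sum>k<n b. \<bar>A b a k\<bar> * \<bar>Rep_ell2 (z a) (\<gamma> k)\<bar>)"
        by (intro sum_mono) (metis abs_ge_self abs_mult)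
      also have "\<dots> \<le> L2_set (A b a) {..<n b} * L2_set (\<lambda>k. Rep_ell2 (z a) (\<gamma> k)) {..<n b}"
        by (rule L2_set_mult_ineq)
      also have "L2_set (A b a) {..<n b} = sqrt (n b)"
        using A_signs[of a b] a by (simp add: L2_set_def R_def power2_eq_square)
      also have "L2_set (\<lambda>k. Rep_ell2 (z a) (\<gamma> k)) {..<n b} \<le> norm (z a)"
      proof -
        have "(\<Sum>k<n b. (Rep_ell2 (z a) (\<gamma> k))\<^sup>2) = (\<Sum>j\<in>\<gamma> ` {..<n b}. (Rep_ell2 (z a) j)\<^sup>2)"
          by (simp add: sum.reindex[OF \<gamma>_inj])
        also have "\<dots> \<le> (norm (z a))\<^sup>2"
          by (rule sum_Rep_ell2_le) simp
        finally show ?thesis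
          unfolding L2_set_def by (intro real_le_lsqrt) (auto simp: sum_nonneg)
      qed
      also have "norm (z a) \<le> \<kappa>"
        by (rule norm_z[OF a])
      finally show "(\<Sum>k<n b. A b a k * Rep_ell2 (z a) (\<gamma> k)) \<le> sqrt (n b) * \<kappa>"
        by (simp add: mult_left_mono)
    qed
    also have "\<dots> = sqrt (n b) * (N * \<kappa>)"
      using N by simp
    \<comment> \<open>Each row of signs has Euclidean norm \<open>sqrt (n b)\<close>, so one such
      factor cancels from both sides.\<close>
    finally have "sqrt (n b) * sqrt (n b) \<le> sqrt (n b) * (N * \<kappa>)"
      by simp
    then have "sqrt (n b) \<le> N * \<kappa>"
      by (rule mult_left_le_imp_le) (use n_pos[of b] in simp)
    then have "(sqrt (n b))\<^sup>2 \<le> (N * \<kappa>)\<^sup>2"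
      by (intro power_mono) auto
    also have "N * \<kappa> = \<bar>C\<bar> / c * N powr (1 - 1 / p)"
      using N by (simp add: \<kappa>_def powr_diff powr_divide)
    also have "(\<bar>C\<bar> / c * N powr (1 - 1 / p))\<^sup>2 = (\<bar>C\<bar> / c)\<^sup>2 * N powr (2 - 2 / p)"
      unfolding power_mult_distrib by (simp add: power2_eq_square powr_add[symmetric])
    finally show ?thesis
      by (simp add: N_def)
  qed
  then show thesis
    by (intro that) blast
qed

text \<open>The factor \<open>real b + 1\<close> is what later lets \<open>n b\<close> outgrow every
  fixed multiple of the power.\<close>

lemma ex_sign_blocks:
  fixes \<theta> :: real
  assumes "\<theta> < 1"
  obtains m n A where "sign_blocks m n A" "\<forall>b. (real b + 1) * (2 ^ m b) powr \<theta> \<le> real (n b)"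
proof -
  \<comment> \<open>For \<open>p = 1\<close> the exponent \<open>2 - 2 / p\<close> is 0, whereas
    \<open>ex_block_size\<close> takes a positive one. As \<open>2 ^ m\<close> is at least 1,
    raising the exponent only strengthens the requirement on \<open>n\<close>.\<close>
  define \<theta>' where "\<theta>' = max \<theta> (1 / 2)"
  have \<theta>': "0 < \<theta>'" "\<theta>' < 1" "\<theta> \<le> \<theta>'"
    using assms by (auto simp: \<theta>'_def)
  define Q where "Q b m n A \<longleftrightarrow> 1 \<le> n \<and> (\<forall>a\<in>signs (evens m). A a \<in> signs {..<n}) \<and>
      (\<forall>x. sqrt (\<Sum>k<n. (x k)\<^sup>2) \<le> 20 * savg (evens m) (\<lambda>a. \<bar>\<Sum>k<n. x k * A a k\<bar>)) \<and>
      (\<forall>x. savg (evens m) (\<lambda>a. (\<Sum>k<n. x k * A a k)\<^sup>2) \<le> 17 * (\<Sum>k<n. (x k)\<^sup>2)) \<and>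
      (real b + 1) * (2 ^ m) powr \<theta> \<le> real n"
    for b m n :: nat and A :: "(nat \<Rightarrow> real) \<Rightarrow> nat \<Rightarrow> real"
  have "\<exists>m n A. Q b m n A" for b
  proof -
    obtain m n :: nat where mn: "1 \<le> n" "2 * (45 * real n) ^ n * (9 / 10 :: real) ^ (2 ^ m) < 1"
      "(real b + 1) * (2 ^ m) powr \<theta>' \<le> real n"
      by (rule ex_block_size[of "real b + 1" \<theta>']) (use \<theta>' in auto)
    have card: "card (signs (evens m)) = 2 ^ m"
      by (simp add: card_signs card_evens)
    obtain A :: "(nat \<Rightarrow> real) \<Rightarrow> nat \<Rightarrow> real" where A: "\<forall>a\<in>signs (evens m). A a \<in> signs {..<n}"
      "\<forall>x. real (card (signs (evens m))) * sqrt (\<Sum>k<n. (x k)\<^sup>2) \<le> 20 * (\<Sum>a\<in>signs (evens m). \<bar>\<Sum>k<n. x k * A a k\<bar>)"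
      "\<forall>x. (\<Sum>a\<in>signs (evens m). (\<Sum>k<n. x k * A a k)\<^sup>2) \<le> 17 * real (card (signs (evens m))) * (\<Sum>k<n. (x k)\<^sup>2)"
      by (rule ex_sign_matrix[OF finite_signs[OF finite_evens] mn(1) mn(2)[folded card]])
    have "(real b + 1) * (2 ^ m) powr \<theta> \<le> (real b + 1) * (2 ^ m) powr \<theta>'"
      using \<theta>' by (intro mult_left_mono powr_mono) auto
    then have "(real b + 1) * (2 ^ m) powr \<theta> \<le> real n"
      using mn(3) by linarith
    moreover have "sqrt (\<Sum>k<n. (x k)\<^sup>2) \<le> 20 * savg (evens m) (\<lambda>a. \<bar>\<Sum>k<n. x k * A a k\<bar>)" for x
      using A(2)[rule_format, of x] by (simp add: savg_def card card_evens pos_le_divide_eq mult.commute)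
    moreover have "savg (evens m) (\<lambda>a. (\<Sum>k<n. x k * A a k)\<^sup>2) \<le> 17 * (\<Sum>k<n. (x k)\<^sup>2)" for x
      using A(3)[rule_format, of x] by (simp add: savg_def card card_evens pos_divide_le_eq mult_ac)
    ultimately have "Q b m n A"
      unfolding Q_def using mn(1) A(1) by blast
    then show ?thesis
      by blast
  qed
  then obtain m n A where Q: "\<And>b. Q b (m b) (n b) (A b)"
    by metis
  show thesis
  proof (rule that[of m n A])
    show "sign_blocks m n A"
      using Q unfolding Q_def by unfold_locales blast+
    show "\<forall>b. (real b + 1) * (2 ^ m b) powr \<theta> \<le> real (n b)"
      using Q unfolding Q_def by blast
  qed
qed

theorem theorem7:
  fixes p :: real
  assumes "1 \<le> p" and "p < 2"
  shows "\<exists>W. closed_subspace_Lp p W \<and> isomorphic_to_ell2 p W \<and> \<not> complemented_in_Lp p W"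
proof -
  have "2 - 2 / p < 1"
    using assms by (simp add: field_simps)
  then obtain m n A where blocks: "sign_blocks m n A"
    and large: "\<forall>b. (real b + 1) * (2 ^ m b) powr (2 - 2 / p) \<le> real (n b)"
    by (rule ex_sign_blocks)
  interpret sign_blocks m n A
    by (rule blocks)
  obtain \<beta> :: "nat \<Rightarrow> nat \<times> nat" where \<beta>: "bij_betw \<beta> UNIV idx"
    by (rule idx_enumeration)
  define e where "e j = abs_L0 (fn (\<beta> j))" for j
  have e_in_Lp: "e j \<in> Lp p" for j
    unfolding e_def by (rule fn_in_Lp)
  \<comment> \<open>The block estimates hold for every finite subset of \<open>idx\<close>, in
    whatever order, so they can be pulled back along the enumeration \<open>\<beta>\<close>.\<close>
  have est: "1 / 80 * sqrt (\<Sum>j<M. (y j)\<^sup>2) \<le> Lp_norm p (\<Sum>j<M. y j *\<^sub>R e j) \<and>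
      Lp_norm p (\<Sum>j<M. y j *\<^sub>R e j) \<le> 10 * sqrt (\<Sum>j<M. (y j)\<^sup>2)" for M y
  proof -
    have inj: "inj_on \<beta> {..<M}" and inv: "\<And>j. inv \<beta> (\<beta> j) = j"
      using bij_betw_imp_inj_on[OF \<beta>] by (auto intro: inj_on_subset)
    have "\<beta> ` {..<M} \<subseteq> idx"
      using \<beta> by (auto simp: bij_betw_def)
    then show ?thesis
      using norm_estimates[of p "\<beta> ` {..<M}" "\<lambda>q. y (inv \<beta> q)"] assms
      by (simp add: sum.reindex[OF inj] inv e_def)
  qed
  obtain T :: "ell2 \<Rightarrow> L0" where T: "linear T" "\<forall>y. T y \<in> Lp p"
    "\<forall>y. 1 / 80 * norm y \<le> Lp_norm p (T y)" "\<forall>y. Lp_norm p (T y) \<le> 10 * norm y"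
    "\<forall>j. T (ell2_unit j) = e j"
    by (rule ell2_embedding_of_basis[OF assms(1) e_in_Lp _ est[THEN conjunct1] est[THEN conjunct2]]) simp
  have "\<not> complemented_in_Lp p (range T)"
  proof
    assume compl: "complemented_in_Lp p (range T)"
    obtain K where K: "\<forall>b. real (n b) \<le> K * (2 ^ m b) powr (2 - 2 / p)"
      by (rule block_size_bound_of_projection[OF assms(1) \<beta> T(1) T(2,5)[unfolded e_def, rule_format] _ T(3)[rule_format] compl]) simp
    obtain b :: nat where "K < real b"
      using reals_Archimedean2 by blast
    have "(real b + 1) * (2 ^ m b) powr (2 - 2 / p) \<le> K * (2 ^ m b) powr (2 - 2 / p)"
      using large K by (meson order_trans)
    then have "real b + 1 \<le> K"
      by (simp add: mult_le_cancel_right)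
    with \<open>K < real b\<close> show False
      by simp
  qed
  moreover have "closed_subspace_Lp p (range T)" "isomorphic_to_ell2 p (range T)"
    by (rule range_isomorphic_closed[OF assms(1) T(1) T(2)[rule_format] _ _ T(3,4)[rule_format]]; simp)+
  ultimately show ?thesis
    by blast
qed

end
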